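(* Let $0<\varepsilon<1$. The open set $\Omega_\varepsilon = B_1\setminus\overline{F^\varepsilon}\subset\mathbb{R}^2$ satisfies $P(\Omega_\varepsilon)<\mathcal{H}^1(\partial\Omega_\varepsilon)$.
   Context: $B_r$ is the open Euclidean disk of radius $r$ centered at the origin of $\mathbb{R}^2$; $P(\cdot)$ is the De Giorgi perimeter in $\mathbb{R}^2$, $\mathcal{H}^1$ the 1-dimensional Hausdorff measure, $\partial$ the topological boundary. Construction of $\Omega_\varepsilon$ (for $0<\varepsilon<1$), with $\mathbb{N}=\{1,2,\dots\}$. Let $C^\varepsilon_0=[-\varepsilon,\varepsilon]\times\{0\}$. For $i\ge1$, $C^\varepsilon_i$ is obtained from $C^\varepsilon_{i-1}$ (a disjoint union of $2^{i-1}$ closed segments of equal length) by removing $2^{i-1}$ open segments $S^i_j$, $j=1,\dots,2^{i-1}$, one centered in the middle of each closed segment of $C^\varepsilon_{i-1}$, each of length $\mathcal{H}^1(S^i_j)=2^{1-2i}\mathcal{H}^1(C^\varepsilon_{i-1})$. Let $C^\varepsilon=\bigcap_i C^\varepsilon_i$. For $\delta\in(0,1)$ let $f_\delta(x)=1-\sqrt{1-(|x|-\delta)^2}$ if $x\in(-\delta,\delta)$, $f_\delta(x)=0$ otherwise, and $F_\delta=\{(x,y)\in\mathbb{R}^2: |x|\le\delta,\ |y|\le f_\delta(x)\}$. Put $\delta_i=2^{-2i}\mathcal{H}^1(C^\varepsilon_{i-1})$, let $m^i_j$ be the midpoint of $S^i_j$, $F^i_j=m^i_j+F_{\delta_i}$,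 and $F^\varepsilon=\bigcup_{i\in\mathbb{N}}\bigcup_{j=1}^{2^{i-1}}F^i_j$. Finally $\Omega_\varepsilon=B_1\setminus\overline{F^\varepsilon}$. *)

theory Defs
  imports "HOL-Analysis.Analysis"
begin

section \<open>One-dimensional Hausdorff measure\<close>

text \<open>The usual constant \<open>\<omega>\<^sub>1 / 2\<close> equals 1. Boundedness of the covering sets is
  required because \<^const>\<open>diameter\<close> is 0 on unbounded sets.\<close>

definition hausdorff1_pre :: "real \<Rightarrow> 'a::metric_space set \<Rightarrow> ennreal" where
  "hausdorff1_pre d A =
     (INF U\<in>{U :: nat \<Rightarrow> 'a set. A \<subseteq> (\<Union>n. U n) \<and> (\<forall>n. bounded (U n) \<and> diameter (U n) \<le> d)}.
        \<Sum>n. ennreal (diameter (U n)))"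

definition hausdorff1 :: "'a::metric_space set \<Rightarrow> ennreal" where
  "hausdorff1 A = (SUP d\<in>{0<..}. hausdorff1_pre d A)"

section \<open>De Giorgi perimeter\<close>

definition divergence :: "('a::euclidean_space \<Rightarrow> 'a) \<Rightarrow> 'a \<Rightarrow> real" where
  "divergence \<phi> x = (\<Sum>b\<in>Basis. frechet_derivative \<phi> (at x) b \<bullet> b)"

definition C1_field :: "('a::euclidean_space \<Rightarrow> 'a) \<Rightarrow> bool" where
  "C1_field \<phi> \<longleftrightarrow>
     (\<exists>D :: 'a \<Rightarrow> 'a \<Rightarrow>\<^sub>L 'a.
        (\<forall>x. (\<phi> has_derivative blinfun_apply (D x)) (at x)) \<and> continuous_on UNIV D)"

definition perimeter_test_fields :: "('a::euclidean_space \<Rightarrow> 'a) set" where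
  "perimeter_test_fields =
     {\<phi>. C1_field \<phi> \<and> compact (closure {x. \<phi> x \<noteq> 0}) \<and> (\<forall>x. norm (\<phi> x) \<le> 1)}"

text \<open>The coercion \<^const>\<open>ennreal\<close> truncates negative values, which is harmless here: the
  zero field is a test field, so the supremum of the integrals is nonnegative anyway.\<close>

definition perimeter :: "'a::euclidean_space set \<Rightarrow> ennreal" where
  "perimeter E =
     (SUP \<phi>\<in>perimeter_test_fields. ennreal (set_lebesgue_integral lebesgue E (divergence \<phi>)))"

section \<open>The set \<open>\<Omega>\<^sub>\<epsilon>\<close>\<close>

text \<open>For a disjoint union of finitely many closed segments, the segments are its connected
  components, so this is the set of their midpoints.\<close>

definition segment_midpoints :: "(real \<times> real) set \<Rightarrow> (real \<times> real) set" where
  "segment_midpoints A = {midpoint p q | p q. closed_segment p q \<in> components A}"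

text \<open>The open segments removed at step \<open>i\<close> are centred at the midpoints and have length
  \<open>2\<^sup>1\<^sup>-\<^sup>2\<^sup>i\<close> times the measure of stage \<open>i - 1\<close>, hence half-length
  \<open>2\<^sup>-\<^sup>2\<^sup>i\<close> times that measure.\<close>

primrec cantor_stage :: "real \<Rightarrow> nat \<Rightarrow> (real \<times> real) set" where
  "cantor_stage \<epsilon> 0 = closed_segment (- \<epsilon>, 0) (\<epsilon>, 0)"
| "cantor_stage \<epsilon> (Suc n) =
     (let r = enn2real (hausdorff1 (cantor_stage \<epsilon> n)) / 2 ^ (2 * Suc n)
      in cantor_stage \<epsilon> n -
           (\<Union>m\<in>segment_midpoints (cantor_stage \<epsilon> n). open_segment (m - (r, 0)) (m + (r, 0))))"

definition cantor_delta :: "real \<Rightarrow> nat \<Rightarrow> real" where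
  "cantor_delta \<epsilon> i = enn2real (hausdorff1 (cantor_stage \<epsilon> (i - 1))) / 2 ^ (2 * i)"

definition arc_profile :: "real \<Rightarrow> real \<Rightarrow> real" where
  "arc_profile \<delta> x = (if x \<in> {- \<delta><..<\<delta>} then 1 - sqrt (1 - (\<bar>x\<bar> - \<delta>)\<^sup>2) else 0)"

definition lens :: "real \<Rightarrow> (real \<times> real) set" where
  "lens \<delta> = {(x, y). \<bar>x\<bar> \<le> \<delta> \<and> \<bar>y\<bar> \<le> arc_profile \<delta> x}"

definition lens_union :: "real \<Rightarrow> (real \<times> real) set" where
  "lens_union \<epsilon> =
     (\<Union>i\<in>{1..}. \<Union>m\<in>segment_midpoints (cantor_stage \<epsilon> (i - 1)). (+) m ` lens (cantor_delta \<epsilon> i))"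

definition Omega :: "real \<Rightarrow> (real \<times> real) set" where
  "Omega \<epsilon> = ball 0 1 - closure (lens_union \<epsilon>)"

lemma open_Omega: "open (Omega \<epsilon>)"
  unfolding Omega_def by (intro open_Diff open_ball closed_closure)

end

theory Submission
  imports Defs
begin

text \<open>
  The perimeter of \<open>\<Omega>\<^sub>\<epsilon>\<close> does not see the Cantor set \<open>C\<close> onto which the lenses accumulate, whereas
  \<open>C\<close> lies in the boundary and has positive length. Let \<open>T\<close> be the total length of the gaps, so that
  \<open>C\<close> has length \<open>2 \<epsilon> - T\<close>.

  Upper bound for the perimeter. Outside the axis, the closure of the union of the lenses adds no
  point to that union, and the axis is a null set. So the integral of \<open>div \<phi>\<close> over \<open>\<Omega>\<^sub>\<epsilon>\<close> is the integral
  over the disc minus the sum of the integrals over the lenses. The disc and the lenses all have the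
  form \<open>a \<le> x \<le> b\<close>, \<open>\<bar>y\<bar> \<le> f x\<close> with \<open>f\<close> vanishing at \<open>a\<close> and \<open>b\<close>, and for such a region Fubini and the
  fundamental theorem of calculus bound the integral of \<open>div \<phi>\<close> by the length \<open>2 \<integral> sqrt (1 + f'\<^sup>2)\<close> of
  its boundary (\<open>abs_divergence_integral_le\<close>). For the disc this is \<open>2 \<pi>\<close>. The arcs of a lens have slope at most
  \<open>1 / sqrt 3\<close>, so its boundary is at most \<open>29 / 25\<close> times as long as twice its gap. Hence the
  perimeter is at most \<open>2 \<pi> + (58 / 25) T\<close> (\<open>perimeter_Omega_le\<close>).

  Lower bound for the boundary. It contains the unit circle, the upper arcs, the lower arcs and \<open>C\<close>.
  Once the arcs are cut off near their end points, these four parts have positive mutual distance,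
  so their Hausdorff measures add up. The circle contributes \<open>2 \<pi>\<close>, and the other three parts
  contribute at least the lengths of their projections to the axis. As the cut-off tends to zero this gives
  \<open>2 \<pi> + T + T + (2 \<epsilon> - T)\<close> (\<open>hausdorff1_frontier_Omega_ge\<close>).

  The two bounds differ by \<open>2 \<epsilon> - (33 / 25) T\<close>. The gap of the first step has length \<open>\<epsilon>\<close> and all later
  gaps together have length at most \<open>\<epsilon> / 2\<close>, so \<open>T \<le> (3 / 2) \<epsilon>\<close> (\<open>total_gap_length_le\<close>) and the difference is
  positive: replacing arcs by chords costs less than the length of \<open>C\<close>.
\<close>

section \<open>Estimates for one-dimensional Hausdorff measure\<close>

lemma hausdorff1_pre_le_hausdorff1:
  assumes "0 < d"
  shows "hausdorff1_pre d A \<le> hausdorff1 A"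
  using assms unfolding hausdorff1_def by (intro SUP_upper) auto

lemma hausdorff1_pre_antimono:
  assumes "d \<le> e"
  shows "hausdorff1_pre e A \<le> hausdorff1_pre d A"
  unfolding hausdorff1_pre_def using assms by (intro INF_superset_mono) (auto intro: order_trans)

lemma hausdorff1_mono:
  assumes "A \<subseteq> B"
  shows "hausdorff1 A \<le> hausdorff1 B"
  unfolding hausdorff1_def hausdorff1_pre_def using assms
  by (intro SUP_mono' INF_superset_mono) auto

text \<open>A finite cover becomes a sequence by appending empty sets, whose diameter is 0.\<close>

lemma hausdorff1_pre_le_finite_cover:
  assumes "finite J" "A \<subseteq> (\<Union>j\<in>J. V j)" "\<And>j. j \<in> J \<Longrightarrow> bounded (V j)"
    and "\<And>j. j \<in> J \<Longrightarrow> diameter (V j) \<le> d" "0 \<le> d"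
  shows "hausdorff1_pre d A \<le> (\<Sum>j\<in>J. ennreal (diameter (V j)))"
proof -
  obtain h where h: "bij_betw h {0..<card J} J"
    using ex_bij_betw_nat_finite[OF assms(1)] by blast
  define U where "U n = (if n < card J then V (h n) else {})" for n
  have hJ: "h n \<in> J" if "n < card J" for n
    using h that by (auto simp: bij_betw_def)
  have "A \<subseteq> (\<Union>n. U n)"
  proof
    fix x assume "x \<in> A"
    then obtain j where j: "j \<in> J" "x \<in> V j" using assms(2) by auto
    then obtain n where "n < card J" "h n = j" using bij_betw_imp_surj_on[OF h] by force
    then show "x \<in> (\<Union>n. U n)" using j by (auto simp: U_def)
  qed
  moreover have "bounded (U n) \<and> diameter (U n) \<le> d" for n
    using assms(3-5) hJ by (auto simp: U_def)
  ultimately have "hausdorff1_pre d A \<le> (\<Sum>n. ennreal (diameter (U n)))"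
    unfolding hausdorff1_pre_def by (intro INF_lower) auto
  also have "\<dots> = (\<Sum>n\<in>{0..<card J}. ennreal (diameter (U n)))"
    by (rule suminf_finite) (auto simp: U_def)
  also have "\<dots> = (\<Sum>n\<in>{0..<card J}. ennreal (diameter (V (h n))))"
    by (intro sum.cong) (auto simp: U_def)
  also have "\<dots> = (\<Sum>j\<in>J. ennreal (diameter (V j)))"
    by (rule sum.reindex_bij_betw[OF h])
  finally show ?thesis .
qed

text \<open>Caratheodory's criterion for metric outer measures: a set of diameter less than the distance
  of \<open>A\<close> and \<open>B\<close> meets at most one of them, so a fine cover of the union contains
  two disjoint subfamilies that cover \<open>A\<close> and \<open>B\<close>.\<close>

lemma hausdorff1_separated_Un:
  assumes "0 < e" "\<And>x y. x \<in> A \<Longrightarrow> y \<in> B \<Longrightarrow> e \<le> dist x y"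
  shows "hausdorff1 A + hausdorff1 B \<le> hausdorff1 (A \<union> B)"
proof -
  have sep: "hausdorff1_pre d A + hausdorff1_pre d B \<le> hausdorff1_pre d (A \<union> B)" if "d < e" for d
    unfolding hausdorff1_pre_def[of d "A \<union> B"]
  proof (rule INF_greatest)
    fix U :: "nat \<Rightarrow> 'a set"
    assume "U \<in> {U. A \<union> B \<subseteq> (\<Union>n. U n) \<and> (\<forall>n. bounded (U n) \<and> diameter (U n) \<le> d)}"
    then have U: "A \<subseteq> (\<Union>n. U n)" "B \<subseteq> (\<Union>n. U n)"
      "\<And>n. bounded (U n)" "\<And>n. diameter (U n) \<le> d" by auto
    \<comment> \<open>The part of the cover that is needed for \<open>X\<close>.\<close>
    define V where "V X n = (if U n \<inter> X = {} then {} else U n)" for X n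
    have d0: "0 \<le> d" using U(4)[of 0] diameter_ge_0[OF U(3)[of 0]] by linarith
    have V: "hausdorff1_pre d X \<le> (\<Sum>n. ennreal (diameter (V X n)))" if "X \<subseteq> (\<Union>n. U n)" for X
      unfolding hausdorff1_pre_def using that U d0
      by (intro INF_lower) (auto simp: V_def, blast)
    have V_le: "diameter (V X n) \<le> diameter (U n)" for X n
      using diameter_ge_0[OF U(3)] by (auto simp: V_def)
    have "diameter (V A n) = 0 \<or> diameter (V B n) = 0" for n
    proof (rule ccontr)
      assume *: "\<not> ?thesis"
      then obtain x y where "x \<in> A" "y \<in> B" "x \<in> U n" "y \<in> U n"
        by (auto simp: V_def split: if_splits)
      then show False using assms(2)[of x y] diameter_bounded_bound[OF U(3), of x n y] U(4)[of n] that
        by linarith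
    qed
    then have "ennreal (diameter (V A n)) + ennreal (diameter (V B n)) \<le> ennreal (diameter (U n))" for n
      by (metis V_le add.left_neutral add.right_neutral ennreal_0 ennreal_leI)
    then have "(\<Sum>n. ennreal (diameter (V A n)) + ennreal (diameter (V B n))) \<le> (\<Sum>n. ennreal (diameter (U n)))"
      by (intro suminf_le) auto
    also have "(\<Sum>n. ennreal (diameter (V A n)) + ennreal (diameter (V B n)))
        = (\<Sum>n. ennreal (diameter (V A n))) + (\<Sum>n. ennreal (diameter (V B n)))"
      by (intro suminf_add[symmetric]) auto
    finally show "hausdorff1_pre d A + hausdorff1_pre d B \<le> (\<Sum>n. ennreal (diameter (U n)))"
      using add_mono[OF V[OF U(1)] V[OF U(2)]] by (rule order_trans[rotated])
  qed
  have "hausdorff1_pre c A + hausdorff1_pre d B \<le> hausdorff1 (A \<union> B)" if "0 < c" "0 < d" for c d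
  proof -
    define k where "k = min (min c d) (e / 2)"
    have k: "0 < k" "k < e" "k \<le> c" "k \<le> d" using assms(1) that by (auto simp: k_def)
    have "hausdorff1_pre c A + hausdorff1_pre d B \<le> hausdorff1_pre k A + hausdorff1_pre k B"
      using k by (intro add_mono hausdorff1_pre_antimono)
    also have "\<dots> \<le> hausdorff1 (A \<union> B)"
      using sep[OF k(2)] hausdorff1_pre_le_hausdorff1[OF k(1)] by (rule order_trans)
    finally show ?thesis .
  qed
  then have "hausdorff1 A + hausdorff1_pre d B \<le> hausdorff1 (A \<union> B)" if "0 < d" for d
    unfolding hausdorff1_def[of A] using that
    by (subst ennreal_SUP_add_left[symmetric]) (auto intro!: SUP_least)
  then show ?thesis
    unfolding hausdorff1_def[of B]
    by (subst ennreal_SUP_add_right) (auto intro!: SUP_least)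
qed

text \<open>All lower bounds for Hausdorff measure are drawn from this fact. The map \<open>\<gamma>\<close> may contract distances by a
  factor at most \<open>K\<close>, and only pairs of points whose images are close are tested: a set of small
  diameter then has a preimage that lies in an interval at most \<open>K\<close> times as long as that diameter.\<close>

lemma emeasure_le_hausdorff1:
  fixes \<gamma> :: "real \<Rightarrow> 'a::metric_space"
  assumes S: "S \<in> sets borel" and "\<gamma> ` S \<subseteq> A" and "0 < K" "0 < d"
    and exp: "\<And>s t. s \<in> S \<Longrightarrow> t \<in> S \<Longrightarrow> dist (\<gamma> s) (\<gamma> t) \<le> d \<Longrightarrow> \<bar>s - t\<bar> \<le> K * dist (\<gamma> s) (\<gamma> t)"
  shows "emeasure lborel S \<le> ennreal K * hausdorff1 A"
proof -
  have "emeasure lborel S / ennreal K \<le> hausdorff1_pre d A"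
    unfolding hausdorff1_pre_def
  proof (rule INF_greatest)
    fix U :: "nat \<Rightarrow> 'a set"
    assume "U \<in> {U. A \<subseteq> (\<Union>n. U n) \<and> (\<forall>n. bounded (U n) \<and> diameter (U n) \<le> d)}"
    then have U: "A \<subseteq> (\<Union>n. U n)" "\<And>n. bounded (U n)" "\<And>n. diameter (U n) \<le> d" by auto
    define T where "T n = {s \<in> S. \<gamma> s \<in> U n}" for n
    define I where "I n = (if T n = {} then {} else {Inf (T n)..Sup (T n)})" for n
    have T: "\<bar>s - t\<bar> \<le> K * diameter (U n)" if "s \<in> T n" "t \<in> T n" for s t n
    proof -
      have "dist (\<gamma> s) (\<gamma> t) \<le> diameter (U n)"
        using that diameter_bounded_bound[OF U(2)] by (auto simp: T_def)
      moreover from this have "\<bar>s - t\<bar> \<le> K * dist (\<gamma> s) (\<gamma> t)"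
        using that U(3)[of n] by (intro exp) (auto simp: T_def)
      ultimately show ?thesis using \<open>0 < K\<close> by (smt (verit) mult_left_mono)
    qed
    have bdd: "bdd_above (T n)" "bdd_below (T n)" for n
    proof -
      have "bdd_above (T n) \<and> bdd_below (T n)"
      proof (cases "T n = {}")
        case False
        then obtain t where t: "t \<in> T n" by auto
        show ?thesis
          using T[OF _ t] by (auto intro!: bdd_aboveI[of _ "t + K * diameter (U n)"]
            bdd_belowI[of _ "t - K * diameter (U n)"]) (smt (verit))+
      qed auto
      then show "bdd_above (T n)" "bdd_below (T n)" by auto
    qed
    have I: "emeasure lborel (I n) \<le> ennreal K * ennreal (diameter (U n))" for n
    proof (cases "T n = {}")
      case False
      have "Sup (T n) \<le> Inf (T n) + K * diameter (U n)"
      proof (rule cSup_least[OF False])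
        fix s assume s: "s \<in> T n"
        have "s - K * diameter (U n) \<le> Inf (T n)"
          using T[OF s] by (intro cInf_greatest[OF False]) (smt (verit))
        then show "s \<le> Inf (T n) + K * diameter (U n)" by simp
      qed
      moreover have "Inf (T n) \<le> Sup (T n)"
        using False bdd[of n] by (simp add: cInf_le_cSup)
      ultimately show ?thesis using False \<open>0 < K\<close>
        by (simp add: I_def ennreal_mult'[symmetric] ennreal_leI)
    qed (auto simp: I_def)
    have "S \<subseteq> (\<Union>n. I n)"
    proof
      fix s assume "s \<in> S"
      then obtain n where "s \<in> T n" using U(1) assms(2) by (auto simp: T_def)
      then have "s \<in> I n" using bdd by (auto simp: I_def intro: cSup_upper cInf_lower)
      then show "s \<in> (\<Union>n. I n)" by auto
    qed
    then have "emeasure lborel S \<le> emeasure lborel (\<Union>n. I n)"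
      by (intro emeasure_mono) (auto simp: I_def)
    also have "\<dots> \<le> (\<Sum>n. emeasure lborel (I n))"
      by (intro emeasure_subadditive_countably) (auto simp: I_def)
    also have "\<dots> \<le> (\<Sum>n. ennreal K * ennreal (diameter (U n)))"
      using I by (intro suminf_le) auto
    also have "\<dots> = ennreal K * (\<Sum>n. ennreal (diameter (U n)))" by simp
    finally show "emeasure lborel S / ennreal K \<le> (\<Sum>n. ennreal (diameter (U n)))"
      using \<open>0 < K\<close> by (intro divide_le_posI_ennreal) (auto simp: mult.commute)
  qed
  also have "\<dots> \<le> hausdorff1 A" using \<open>0 < d\<close> by (rule hausdorff1_pre_le_hausdorff1)
  finally have "ennreal K * (emeasure lborel S / ennreal K) \<le> ennreal K * hausdorff1 A"
    by (rule mult_left_mono) simp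
  then show ?thesis using \<open>0 < K\<close>
    by (simp add: ennreal_times_divide mult.commute[of "ennreal K"] ennreal_mult_divide_eq)
qed

text \<open>Projections do not increase distances, so any section of the projection qualifies for \<open>\<gamma>\<close>.\<close>

lemma emeasure_fst_le_hausdorff1:
  fixes A :: "(real \<times> 'a::metric_space) set"
  assumes "S \<in> sets borel" "S \<subseteq> fst ` A"
  shows "emeasure lborel S \<le> hausdorff1 A"
proof -
  define \<gamma> where "\<gamma> = inv_into A fst"
  have \<gamma>: "\<gamma> s \<in> A" "fst (\<gamma> s) = s" if "s \<in> S" for s
    using that assms(2) inv_into_into[of s fst A] f_inv_into_f[of s fst A] by (auto simp: \<gamma>_def)
  have "emeasure lborel S \<le> ennreal 1 * hausdorff1 A"
  proof (rule emeasure_le_hausdorff1[where \<gamma>=\<gamma> and d=1])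
    fix s t assume "s \<in> S" "t \<in> S"
    then show "\<bar>s - t\<bar> \<le> 1 * dist (\<gamma> s) (\<gamma> t)"
      using \<gamma>(2) dist_fst_le[of "\<gamma> s" "\<gamma> t"] by (simp add: dist_real_def)
  qed (use assms \<gamma>(1) in auto)
  then show ?thesis by simp
qed

section \<open>The divergence theorem for regions between a graph and its reflection\<close>

lemma divergence_eq:
  assumes "(\<phi> has_derivative L) (at p)"
  shows "divergence \<phi> p = fst (L (1, 0)) + snd (L (0, 1 :: real) :: real \<times> real)"
proof -
  have "frechet_derivative \<phi> (at p) = L"
    using frechet_derivative_at[OF assms] by simp
  then show ?thesis by (simp add: divergence_def Basis_prod_def inner_prod_def)
qed

text \<open>The vector \<open>(- s, 1)\<close> is an upward normal of a graph of slope \<open>s\<close>, with the length element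
  \<open>sqrt (1 + s\<^sup>2)\<close> as its norm.\<close>

lemma abs_normal_component_le:
  fixes v :: "real \<times> real"
  assumes "norm v \<le> 1"
  shows "\<bar>snd v - s * fst v\<bar> \<le> sqrt (1 + s\<^sup>2)"
proof -
  have "\<bar>v \<bullet> (- s, 1)\<bar> \<le> norm v * norm (- s, 1 :: real)" by (rule Cauchy_Schwarz_ineq2)
  also have "\<dots> \<le> 1 * norm (- s, 1 :: real)" using assms by (intro mult_right_mono) auto
  finally show ?thesis by (cases v) (simp add: norm_Pair algebra_simps)
qed

text \<open>The partial derivatives are those of Leibniz's rule and of the fundamental theorem of calculus,
  and continuity of the latter makes them a total derivative. The integral starts at \<open>- N\<close>, a
  fixed point below all \<open>t\<close> that occur.\<close>

lemma has_derivative_vertical_integral: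
  fixes g gx :: "real \<times> real \<Rightarrow> real"
  assumes g: "continuous_on UNIV g" and gx: "continuous_on UNIV gx"
    and der: "\<And>x y. ((\<lambda>x. g (x, y)) has_real_derivative gx (x, y)) (at x)"
    and t: "- N < t" "t < N"
  shows "((\<lambda>(x, t). integral {- N..t} (\<lambda>y. g (x, y))) has_derivative
     (\<lambda>(h, k). integral {- N..t} (\<lambda>y. gx (x, y)) * h + g (x, t) * k)) (at (x, t))"
proof -
  let ?Y = "{- N<..<N}"
  have gc: "continuous_on A (\<lambda>y. g (x, y))" "continuous_on A (\<lambda>y. gx (x, y))" for A x
    by (auto intro!: continuous_on_compose2[OF g] continuous_on_compose2[OF gx] continuous_intros)
  have fx: "((\<lambda>x. integral {- N..t} (\<lambda>y. g (x, y))) has_derivative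
      (\<lambda>h. integral {- N..t} (\<lambda>y. gx (x, y)) * h)) (at x within UNIV)"
  proof -
    have "((\<lambda>x. integral (cbox (- N) t) (\<lambda>y. g (x, y))) has_real_derivative
        integral (cbox (- N) t) (\<lambda>y. gx (x, y))) (at x within UNIV)"
      using der by (intro leibniz_rule_field_derivative)
        (auto intro!: integrable_continuous_real gc continuous_on_subset[OF gx])
    then show ?thesis by (simp add: has_field_derivative_def)
  qed
  have fy: "((\<lambda>t. integral {- N..t} (\<lambda>y. g (x, y))) has_derivative
      blinfun_apply (blinfun_mult_right (g (x, t)))) (at t within ?Y)" if "t \<in> ?Y" for x t
  proof -
    have "((\<lambda>t. integral {- N..t} (\<lambda>y. g (x, y))) has_real_derivative g (x, t)) (at t within {- N..N})"
      using that by (intro integral_has_real_derivative gc) auto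
    then have "((\<lambda>t. integral {- N..t} (\<lambda>y. g (x, y))) has_real_derivative g (x, t)) (at t within ?Y)"
      by (rule has_field_derivative_subset) auto
    then show ?thesis by (simp add: has_field_derivative_def)
  qed
  have "((\<lambda>(x, t). integral {- N..t} (\<lambda>y. g (x, y))) has_derivative
     (\<lambda>(h, k). integral {- N..t} (\<lambda>y. gx (x, y)) * h + blinfun_mult_right (g (x, t)) k))
     (at (x, t) within UNIV \<times> ?Y)"
  proof (rule has_derivative_partialsI[OF fx fy])
    have "continuous_on UNIV (\<lambda>p. blinfun_mult_right (g p))"
      by (intro g bounded_linear.continuous_on[OF bounded_linear_blinfun_mult_right])
    then show "continuous (at (x, t) within UNIV \<times> ?Y) (\<lambda>(x, y). blinfun_mult_right (g (x, y)))"
      by (simp add: case_prod_unfold continuous_on_eq_continuous_at continuous_at_imp_continuous_at_within)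
  qed (use t in auto)
  moreover have "open (UNIV \<times> ?Y :: (real \<times> real) set)" by (intro open_Times) auto
  ultimately show ?thesis using t by (simp add: at_within_open[of _ "UNIV \<times> ?Y"])
qed

text \<open>Both the closed disc and the translated lenses have this shape, which allows one divergence
  theorem to serve for both.\<close>

definition profile_region :: "real \<Rightarrow> real \<Rightarrow> (real \<Rightarrow> real) \<Rightarrow> (real \<times> real) set" where
  "profile_region a b f = {(x, y). a \<le> x \<and> x \<le> b \<and> \<bar>y\<bar> \<le> f x}"

lemma abs_bound_on_Icc:
  fixes f :: "real \<Rightarrow> real"
  assumes "continuous_on {a..b} f"
  obtains M where "\<And>x. x \<in> {a..b} \<Longrightarrow> \<bar>f x\<bar> \<le> M"
proof -
  have "bounded (f ` {a..b})"
    using assms by (intro compact_imp_bounded compact_continuous_image) auto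
  then obtain M where "\<forall>x\<in>{a..b}. \<bar>f x\<bar> \<le> M" by (auto simp: bounded_iff)
  then show ?thesis using that by blast
qed

lemma compact_profile_region:
  assumes f: "continuous_on {a..b} f"
  shows "compact (profile_region a b f)"
proof -
  obtain M where M: "\<And>x. x \<in> {a..b} \<Longrightarrow> \<bar>f x\<bar> \<le> M"
    using abs_bound_on_Icc[OF f] by blast
  have "profile_region a b f = {p \<in> {a..b} \<times> {- M..M}. \<bar>snd p\<bar> \<le> f (fst p)}"
    using M by (force simp: profile_region_def abs_le_iff)
  also have "compact \<dots>"
  proof -
    let ?K = "{a..b} \<times> {- M..M}"
    have K: "compact ?K" by (intro compact_Times compact_Icc)
    have "closed {p \<in> ?K. \<bar>snd p\<bar> \<le> f (fst p)}"
      by (intro continuous_on_closed_Collect_le compact_imp_closed K continuous_intros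
          continuous_on_compose2[OF f]) auto
    moreover have "bounded {p \<in> ?K. \<bar>snd p\<bar> \<le> f (fst p)}"
      by (rule bounded_subset[OF compact_imp_bounded[OF K]]) auto
    ultimately show ?thesis by (simp add: compact_eq_bounded_closed)
  qed
  finally show ?thesis .
qed

lemma C1_field_divergence:
  fixes \<phi> :: "real \<times> real \<Rightarrow> real \<times> real"
  assumes "C1_field \<phi>"
  obtains P Q where "continuous_on UNIV P" "continuous_on UNIV Q" "divergence \<phi> = (\<lambda>p. P p + Q p)"
    "\<And>x y. ((\<lambda>x. fst (\<phi> (x, y))) has_real_derivative P (x, y)) (at x)"
    "\<And>x y. ((\<lambda>y. snd (\<phi> (x, y))) has_real_derivative Q (x, y)) (at y)"
proof -
  obtain D where D: "\<And>p. (\<phi> has_derivative blinfun_apply (D p)) (at p)" "continuous_on UNIV D"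
    using assms by (auto simp: C1_field_def)
  show ?thesis
  proof (rule that[of "\<lambda>p. fst (D p (1, 0))" "\<lambda>p. snd (D p (0, 1))"])
    show "((\<lambda>x. fst (\<phi> (x, y))) has_real_derivative fst (D (x, y) (1, 0))) (at x)" for x y
    proof -
      have "((\<lambda>x. fst (\<phi> (x, y))) has_derivative (\<lambda>h. fst (D (x, y) (h, 0)))) (at x)"
        by (rule has_derivative_fst[OF has_derivative_compose[OF
              has_derivative_Pair[OF has_derivative_ident has_derivative_const] D(1)]])
      moreover have "(\<lambda>h. fst (D (x, y) (h, 0))) = (*) (fst (D (x, y) (1, 0)))"
      proof
        show "fst (D (x, y) (h, 0)) = fst (D (x, y) (1, 0)) * h" for h
          using blinfun.scaleR_right[of "D (x, y)" h "(1, 0)"] by (simp add: mult.commute)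
      qed
      ultimately show ?thesis unfolding has_field_derivative_def by (rule has_derivative_eq_rhs)
    qed
    show "((\<lambda>y. snd (\<phi> (x, y))) has_real_derivative snd (D (x, y) (0, 1))) (at y)" for x y
    proof -
      have "((\<lambda>y. snd (\<phi> (x, y))) has_derivative (\<lambda>h. snd (D (x, y) (0, h)))) (at y)"
        by (rule has_derivative_snd[OF has_derivative_compose[OF
              has_derivative_Pair[OF has_derivative_const has_derivative_ident] D(1)]])
      moreover have "(\<lambda>h. snd (D (x, y) (0, h))) = (*) (snd (D (x, y) (0, 1)))"
      proof
        show "snd (D (x, y) (0, h)) = snd (D (x, y) (0, 1)) * h" for h
          using blinfun.scaleR_right[of "D (x, y)" h "(0, 1)"] by (simp add: mult.commute)
      qed
      ultimately show ?thesis unfolding has_field_derivative_def by (rule has_derivative_eq_rhs)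
    qed
  qed (auto intro!: continuous_intros D(2) simp: divergence_eq[OF D(1)])
qed

lemma C1_field_continuous:
  assumes "C1_field \<phi>"
  shows "continuous_on A \<phi>"
proof -
  have "isCont \<phi> p" for p
    using assms has_derivative_continuous unfolding C1_field_def by blast
  then show ?thesis by (simp add: continuous_at_imp_continuous_on)
qed

text \<open>The perimeter is defined with \<^const>\<open>lebesgue\<close>, while Fubini's theorem is at hand for
  \<^const>\<open>lborel\<close>.\<close>

lemma divergence_integral_lborel:
  fixes \<phi> :: "real \<times> real \<Rightarrow> real \<times> real"
  assumes "C1_field \<phi>" "compact K"
  shows "set_integrable lebesgue K (divergence \<phi>)"
    "set_lebesgue_integral lebesgue K (divergence \<phi>) = set_lebesgue_integral lborel K (divergence \<phi>)"
proof -
  obtain P Q where PQ: "continuous_on UNIV P" "continuous_on UNIV Q" "divergence \<phi> = (\<lambda>p. P p + Q p)"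
    using C1_field_divergence[OF assms(1)] by metis
  have "continuous_on K (divergence \<phi>)" unfolding PQ(3)
    by (intro continuous_on_add continuous_on_subset[OF PQ(1)] continuous_on_subset[OF PQ(2)]) auto
  then have *: "set_integrable lborel K (divergence \<phi>)"
    unfolding set_integrable_def by (intro borel_integrable_compact assms(2))
  then show "set_integrable lebesgue K (divergence \<phi>)"
    unfolding set_integrable_def by (subst integrable_completion) auto
  show "set_lebesgue_integral lebesgue K (divergence \<phi>) = set_lebesgue_integral lborel K (divergence \<phi>)"
    unfolding set_lebesgue_integral_def
    by (intro integral_completion borel_measurable_integrable *[unfolded set_integrable_def])
qed

text \<open>Fubini's theorem in gauge-integral form. The gauge integral is used for the outer variable,
  because the fundamental theorem of calculus will be applied to functions with unbounded derivative, such as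
  \<open>sqrt (1 - x\<^sup>2)\<close> at the ends of its interval.\<close>

lemma has_integral_vertical_slices:
  fixes g :: "real \<times> real \<Rightarrow> real"
  assumes g: "continuous_on UNIV g" and f: "continuous_on {a..b} f"
  shows "((\<lambda>x. integral {- f x..f x} (\<lambda>y. g (x, y))) has_integral
     set_lebesgue_integral lborel (profile_region a b f) g) {a..b}"
proof -
  let ?R = "profile_region a b f"
  define G where "G p = indicator ?R p *\<^sub>R g p" for p
  have G: "integrable lborel G" unfolding G_def
    using g by (intro borel_integrable_compact compact_profile_region f) (auto intro: continuous_on_subset)
  then have GP: "integrable (lborel \<Otimes>\<^sub>M lborel) G" by (simp add: lborel_prod)
  define q where "q x = (\<integral>y. G (x, y) \<partial>lborel)" for x
  have q: "q x = (if x \<in> {a..b} then integral {- f x..f x} (\<lambda>y. g (x, y)) else 0)" for x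
  proof (cases "x \<in> {a..b}")
    case True
    have gc: "continuous_on {- f x..f x} (\<lambda>y. g (x, y))"
      by (auto intro!: continuous_on_compose2[OF g] continuous_intros)
    have "q x = (LINT y:{- f x..f x}|lborel. g (x, y))"
      unfolding q_def set_lebesgue_integral_def using True
      by (intro Bochner_Integration.integral_cong)
         (auto simp: G_def profile_region_def indicator_def abs_le_iff)
    also have "\<dots> = integral {- f x..f x} (\<lambda>y. g (x, y))"
      using borel_integrable_compact[OF compact_Icc gc]
      by (intro set_borel_integral_eq_integral) (simp add: set_integrable_def)
    finally show ?thesis using True by simp
  next
    case False
    then have "G (x, y) = 0" for y by (auto simp: G_def profile_region_def)
    then show ?thesis using False by (auto simp: q_def)
  qed
  have "(q has_integral integral\<^sup>L lborel q) UNIV"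
    using lborel_pair.integrable_fst'[OF GP] unfolding q_def[symmetric]
    by (intro has_integral_integral_lborel) simp
  moreover have "integral\<^sup>L lborel q = integral\<^sup>L lborel G"
    using lborel_pair.integral_fst'[OF GP] unfolding q_def[symmetric] lborel_prod .
  ultimately have "((\<lambda>x. if x \<in> {a..b} then integral {- f x..f x} (\<lambda>y. g (x, y)) else 0)
      has_integral integral\<^sup>L lborel G) UNIV"
    by (simp only: q[abs_def])
  then show ?thesis
    unfolding set_lebesgue_integral_def G_def[symmetric] by (simp only: has_integral_restrict_UNIV)
qed

text \<open>Let \<open>\<Psi> x\<close> be the integral of the horizontal component of \<open>\<phi>\<close> over the vertical slice at \<open>x\<close>. It
  vanishes at \<open>a\<close> and \<open>b\<close>, so subtracting \<open>\<Psi>'\<close> from the slice integral \<open>q\<close> of the divergence does not change the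
  total. What remains, \<open>q x - \<Psi>' x\<close>, consists of the two fluxes of \<open>\<phi>\<close> through the upper and the
  lower boundary point above \<open>x\<close>, each of which is at most \<open>sqrt (1 + (f' x)\<^sup>2)\<close>. The finite set \<open>S\<close>
  makes room for corners of the graph.\<close>

lemma abs_divergence_integral_le:
  fixes \<phi> :: "real \<times> real \<Rightarrow> real \<times> real"
  assumes \<phi>: "C1_field \<phi>" "\<And>p. norm (\<phi> p) \<le> 1"
    and "a \<le> b" "finite S"
    and f: "continuous_on {a..b} f" "\<And>x. x \<in> {a..b} \<Longrightarrow> 0 \<le> f x" "f a = 0" "f b = 0"
    and f': "\<And>x. x \<in> {a<..<b} - S \<Longrightarrow> (f has_real_derivative f' x) (at x)"
    and w: "\<And>x. x \<in> {a<..<b} - S \<Longrightarrow> sqrt (1 + (f' x)\<^sup>2) \<le> w x" "(w has_integral J) {a..b}"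
  shows "\<bar>set_lebesgue_integral lebesgue (profile_region a b f) (divergence \<phi>)\<bar> \<le> 2 * J"
proof -
  obtain P Q where P: "continuous_on UNIV P" and Q: "continuous_on UNIV Q"
    and div: "divergence \<phi> = (\<lambda>p. P p + Q p)"
    and dP: "\<And>x y. ((\<lambda>x. fst (\<phi> (x, y))) has_real_derivative P (x, y)) (at x)"
    and dQ: "\<And>x y. ((\<lambda>y. snd (\<phi> (x, y))) has_real_derivative Q (x, y)) (at y)"
    by (rule C1_field_divergence[OF \<phi>(1)]) blast
  have u: "continuous_on UNIV (\<lambda>p. fst (\<phi> p))"
    by (intro continuous_intros C1_field_continuous \<phi>)
  have int: "(\<lambda>y. h (x, y)) integrable_on {c..d}" if "continuous_on UNIV h"
    for h :: "real \<times> real \<Rightarrow> real" and x c d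
    by (auto intro!: integrable_continuous_real continuous_on_compose2[OF that] continuous_intros)
  obtain M where M: "\<And>x. x \<in> {a..b} \<Longrightarrow> \<bar>f x\<bar> \<le> M"
    using abs_bound_on_Icc[OF f(1)] by blast
  \<comment> \<open>Strictly above the graph, so that the slices end inside the interval on which \<open>\<Phi>\<close> is
    differentiable.\<close>
  define N where "N = M + 1"
  have N: "- N < f x" "f x < N" "- N < - f x" "- f x < N" if "x \<in> {a..b}" for x
    using M[OF that] by (auto simp: N_def)
  define \<Phi> where "\<Phi> = (\<lambda>(x, t). integral {- N..t} (\<lambda>y. fst (\<phi> (x, y))))"
  define I where "I x t = integral {- N..t} (\<lambda>y. P (x, y))" for x t
  have d\<Phi>: "(\<Phi> has_derivative (\<lambda>(h, k). I x t * h + fst (\<phi> (x, t)) * k)) (at (x, t))"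
    if "- N < t" "t < N" for x t
    unfolding \<Phi>_def I_def by (rule has_derivative_vertical_integral[OF u P dP that])
  define \<Psi> where "\<Psi> x = \<Phi> (x, f x) - \<Phi> (x, - f x)" for x
  define \<Psi>' where "\<Psi>' x = I x (f x) + fst (\<phi> (x, f x)) * f' x
    - (I x (- f x) + fst (\<phi> (x, - f x)) * (- f' x))" for x
  have "(\<Psi>' has_integral (\<Psi> b - \<Psi> a)) {a..b}"
  proof (rule fundamental_theorem_of_calculus_interior_strong[OF \<open>finite S\<close> \<open>a \<le> b\<close>])
    fix x assume x: "x \<in> {a<..<b} - S"
    then have N': "- N < f x" "f x < N" "- N < - f x" "- f x < N" using N[of x] by auto
    have df: "(f has_derivative (\<lambda>h. f' x * h)) (at x)"
      using f'[OF x] by (simp add: has_field_derivative_def)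
    have d\<Phi>_along: "((\<lambda>x. \<Phi> (x, g x)) has_derivative (\<lambda>h. I x (g x) * h + fst (\<phi> (x, g x)) * (d * h))) (at x)"
      if g: "(g has_derivative (\<lambda>h. d * h)) (at x)" and "- N < g x" "g x < N" for g d
      using has_derivative_compose[OF has_derivative_Pair[OF has_derivative_ident g], of \<Phi>] d\<Phi>[OF that(2,3)]
      by fastforce
    have "(\<Psi> has_derivative (\<lambda>h. I x (f x) * h + fst (\<phi> (x, f x)) * (f' x * h)
        - (I x (- f x) * h + fst (\<phi> (x, - f x)) * (- f' x * h)))) (at x)"
      unfolding \<Psi>_def using has_derivative_minus[OF df]
      by (intro has_derivative_diff d\<Phi>_along df N') simp
    then show "(\<Psi> has_vector_derivative \<Psi>' x) (at x)"
      unfolding has_real_derivative_iff_has_vector_derivative[symmetric] has_field_derivative_def \<Psi>'_def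
      by (rule has_derivative_eq_rhs) (auto simp: algebra_simps)
  next
    have c\<Phi>: "continuous_on (UNIV \<times> {- N<..<N}) \<Phi>"
      by (auto intro!: continuous_at_imp_continuous_on has_derivative_continuous d\<Phi>)
    show "continuous_on {a..b} \<Psi>" unfolding \<Psi>_def
      by (intro continuous_intros continuous_on_compose2[OF c\<Phi>] f) (use N in force)+
  qed
  moreover have "\<Psi> a = 0" "\<Psi> b = 0" by (auto simp: \<Psi>_def f)
  ultimately have \<Psi>0: "(\<Psi>' has_integral 0) {a..b}" by simp
  define q where "q x = integral {- f x..f x} (\<lambda>y. divergence \<phi> (x, y))" for x
  let ?L = "set_lebesgue_integral lborel (profile_region a b f) (divergence \<phi>)"
  have "(q has_integral ?L) {a..b}"
    unfolding q_def div by (intro has_integral_vertical_slices continuous_on_add P Q f)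
  then have "((\<lambda>x. q x - \<Psi>' x) has_integral ?L) {a..b}"
    using has_integral_diff[OF _ \<Psi>0] by fastforce
  moreover have bound: "\<bar>q x - \<Psi>' x\<bar> \<le> 2 * w x" if x: "x \<in> {a<..<b} - S" for x
  proof -
    have x': "x \<in> {a..b}" using x by auto
    have "q x = integral {- f x..f x} (\<lambda>y. P (x, y)) + integral {- f x..f x} (\<lambda>y. Q (x, y))"
      unfolding q_def div by (intro Henstock_Kurzweil_Integration.integral_add int[OF P] int[OF Q])
    also have "integral {- f x..f x} (\<lambda>y. Q (x, y)) = snd (\<phi> (x, f x)) - snd (\<phi> (x, - f x))"
    proof (rule integral_unique, rule fundamental_theorem_of_calculus)
      show "- f x \<le> f x" using f(2)[OF x'] by simp
    qed (use dQ in \<open>auto simp: has_real_derivative_iff_has_vector_derivative[symmetric]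
          intro: has_field_derivative_at_within\<close>)
    also have "integral {- f x..f x} (\<lambda>y. P (x, y)) = I x (f x) - I x (- f x)"
      unfolding I_def using N[OF x'] f(2)[OF x']
        Henstock_Kurzweil_Integration.integral_combine[of "- N" "- f x" "f x" "\<lambda>y. P (x, y)"]
      by (simp add: int[OF P])
    finally have "q x - \<Psi>' x = (snd (\<phi> (x, f x)) - f' x * fst (\<phi> (x, f x)))
        - (snd (\<phi> (x, - f x)) - (- f' x) * fst (\<phi> (x, - f x)))"
      by (simp add: \<Psi>'_def algebra_simps)
    then show ?thesis
      using abs_normal_component_le[OF \<phi>(2)[of "(x, f x)"], of "f' x"] w(1)[OF x]
        abs_normal_component_le[OF \<phi>(2)[of "(x, - f x)"], of "- f' x"] by simp
  qed
  \<comment> \<open>The pointwise bound may fail on this finite set; both integrands are set to 0 there.\<close>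
  let ?E = "S \<union> {a, b}"
  have "((\<lambda>x. if x \<in> ?E then 0 else q x - \<Psi>' x) has_integral ?L) {a..b}"
    using \<open>finite S\<close> by (intro has_integral_spike_finite[OF _ _ calculation, of ?E]) auto
  moreover have "((\<lambda>x. if x \<in> ?E then 0 else 2 * w x) has_integral 2 * J) {a..b}"
    using \<open>finite S\<close>
    by (intro has_integral_spike_finite[OF _ _ has_integral_mult_right[OF w(2), of 2], of ?E]) auto
  ultimately have "\<bar>?L\<bar> \<le> 2 * J"
    using bound integral_norm_bound_integral[of "\<lambda>x. if x \<in> ?E then 0 else q x - \<Psi>' x" "{a..b}"
      "\<lambda>x. if x \<in> ?E then 0 else 2 * w x"]
    by (auto simp: has_integral_iff)
  then show ?thesis
    using divergence_integral_lborel(2)[OF \<phi>(1) compact_profile_region[OF f(1)]] by simp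
qed

section \<open>The disc and the lens\<close>

lemma cball_eq_profile_region:
  "cball 0 1 = profile_region (- 1) 1 (\<lambda>x. sqrt (1 - x\<^sup>2))"
proof -
  have "sqrt (x\<^sup>2 + y\<^sup>2) \<le> 1 \<longleftrightarrow> - 1 \<le> x \<and> x \<le> 1 \<and> \<bar>y\<bar> \<le> sqrt (1 - x\<^sup>2)" for x y :: real
  proof -
    have "- 1 \<le> x \<and> x \<le> 1" if "x\<^sup>2 + y\<^sup>2 \<le> 1"
      using that abs_square_le_1[of x] by (smt (verit) zero_le_power2)
    moreover have "\<bar>y\<bar> \<le> sqrt (1 - x\<^sup>2) \<longleftrightarrow> y\<^sup>2 \<le> 1 - x\<^sup>2"
      using real_sqrt_le_iff[of "y\<^sup>2" "1 - x\<^sup>2"] by simp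
    ultimately show ?thesis by auto
  qed
  then show ?thesis by (auto simp: profile_region_def norm_Pair)
qed

text \<open>For the half circle the length element is \<open>1 / sqrt (1 - x\<^sup>2)\<close>, the derivative of \<^const>\<open>arcsin\<close>.\<close>

lemma abs_divergence_integral_disc_le:
  fixes \<phi> :: "real \<times> real \<Rightarrow> real \<times> real"
  assumes "C1_field \<phi>" "\<And>p. norm (\<phi> p) \<le> 1"
  shows "\<bar>set_lebesgue_integral lebesgue (cball 0 1) (divergence \<phi>)\<bar> \<le> 2 * pi"
  unfolding cball_eq_profile_region
proof (rule abs_divergence_integral_le[OF assms, where S="{}"
      and f'="\<lambda>x. - x / sqrt (1 - x\<^sup>2)" and w="\<lambda>x. inverse (sqrt (1 - x\<^sup>2))"])
  fix x :: real assume "x \<in> {- 1<..<1} - {}"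
  then have x: "0 < 1 - x\<^sup>2" by (simp add: abs_square_less_1 abs_less_iff)
  show "((\<lambda>x. sqrt (1 - x\<^sup>2)) has_real_derivative - x / sqrt (1 - x\<^sup>2)) (at x)"
    using x by (auto intro!: derivative_eq_intros simp: divide_simps)
  have "1 + (- x / sqrt (1 - x\<^sup>2))\<^sup>2 = inverse (1 - x\<^sup>2)"
    using x by (simp add: power_divide field_simps)
  then show "sqrt (1 + (- x / sqrt (1 - x\<^sup>2))\<^sup>2) \<le> inverse (sqrt (1 - x\<^sup>2))"
    by (simp add: real_sqrt_inverse)
next
  have "((\<lambda>x. inverse (sqrt (1 - x\<^sup>2))) has_integral (arcsin 1 - arcsin (- 1))) {- 1..1}"
  proof (rule fundamental_theorem_of_calculus_interior)
    fix x :: real assume "x \<in> {- 1<..<1}"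
    then show "(arcsin has_vector_derivative inverse (sqrt (1 - x\<^sup>2))) (at x)"
      by (auto simp: has_real_derivative_iff_has_vector_derivative[symmetric] intro!: DERIV_arcsin)
  qed (auto intro: continuous_on_arcsin')
  then show "((\<lambda>x. inverse (sqrt (1 - x\<^sup>2))) has_integral pi) {- 1..1}" by simp
qed (auto intro!: continuous_intros simp: abs_square_le_1 abs_le_iff)

lemma arc_profile_eq:
  assumes "\<bar>x\<bar> \<le> \<delta>"
  shows "arc_profile \<delta> x = 1 - sqrt (1 - (\<bar>x\<bar> - \<delta>)\<^sup>2)"
  using assms by (auto simp: arc_profile_def abs_if)

lemma arc_profile_nonneg: "0 \<le> arc_profile \<delta> x"
  by (auto simp: arc_profile_def)

lemma translate_lens:
  "(+) (m, 0) ` lens \<delta> = profile_region (m - \<delta>) (m + \<delta>) (\<lambda>x. arc_profile \<delta> (x - m))"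
proof -
  have "(x, y) \<in> (+) (m, 0) ` lens \<delta> \<longleftrightarrow> (x - m, y) \<in> lens \<delta>" for x y
    by (force simp: image_iff)
  then show ?thesis by (auto simp: profile_region_def lens_def abs_le_iff)
qed

lemma continuous_on_arc_profile:
  "continuous_on {m - \<delta>..m + \<delta>} (\<lambda>x. arc_profile \<delta> (x - m))"
proof -
  have "continuous_on {m - \<delta>..m + \<delta>} (\<lambda>x. 1 - sqrt (1 - (\<bar>x - m\<bar> - \<delta>)\<^sup>2))"
    by (intro continuous_intros)
  then show ?thesis
    by (rule continuous_on_eq) (auto simp: arc_profile_eq abs_le_iff)
qed

text \<open>For \<open>\<delta> \<le> 1 / 2\<close> the squared length element of the arcs is \<open>1 / (1 - (\<bar>x - m\<bar> - \<delta>)\<^sup>2) \<le> 4 / 3\<close>,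
  which is less than \<open>(29 / 25)\<^sup>2\<close>.\<close>

lemma abs_divergence_integral_lens_le:
  fixes \<phi> :: "real \<times> real \<Rightarrow> real \<times> real"
  assumes \<phi>: "C1_field \<phi>" "\<And>p. norm (\<phi> p) \<le> 1" and \<delta>: "0 \<le> \<delta>" "\<delta> \<le> 1 / 2"
  shows "\<bar>set_lebesgue_integral lebesgue ((+) (m, 0) ` lens \<delta>) (divergence \<phi>)\<bar> \<le> 116 / 25 * \<delta>"
proof -
  \<comment> \<open>The sign of \<open>x - m\<close>; the arcs meet in a corner at \<open>x = m\<close>.\<close>
  define s where "s x = (if m < x then 1 else - 1 :: real)" for x
  define f' where "f' x = s x * (\<bar>x - m\<bar> - \<delta>) / sqrt (1 - (\<bar>x - m\<bar> - \<delta>)\<^sup>2)" for x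
  have "\<bar>set_lebesgue_integral lebesgue (profile_region (m - \<delta>) (m + \<delta>) (\<lambda>x. arc_profile \<delta> (x - m)))
      (divergence \<phi>)\<bar> \<le> 2 * (2 * \<delta> * 29 / 25)"
  proof (rule abs_divergence_integral_le[OF \<phi>, where S="{m}" and f'=f' and w="\<lambda>x. 29 / 25"])
    fix x assume x: "x \<in> {m - \<delta><..<m + \<delta>} - {m}"
    have t: "\<bar>\<bar>x - m\<bar> - \<delta>\<bar> \<le> 1 / 2" using x \<delta> by (auto simp: abs_if)
    have u: "(\<bar>x - m\<bar> - \<delta>)\<^sup>2 \<le> 1 / 4" using power_mono[OF t, of 2] by (simp add: power_divide)
    have s: "s x * s x = 1" by (simp add: s_def)
    have ev: "eventually (\<lambda>z. z \<in> {m - \<delta><..<m + \<delta>} - {m} \<and> s z = s x) (nhds x)"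
    proof (cases "m < x")
      case True
      then have "eventually (\<lambda>z. z \<in> {m<..<m + \<delta>}) (nhds x)"
        using x by (intro eventually_nhds_in_open) auto
      then show ?thesis by eventually_elim (use True \<delta> in \<open>auto simp: s_def\<close>)
    next
      case False
      then have "eventually (\<lambda>z. z \<in> {m - \<delta><..<m}) (nhds x)"
        using x by (intro eventually_nhds_in_open) auto
      then show ?thesis by eventually_elim (use False \<delta> in \<open>auto simp: s_def\<close>)
    qed
    have "((\<lambda>z. 1 - sqrt (1 - (s x * (z - m) - \<delta>)\<^sup>2)) has_real_derivative
        s x * (s x * (x - m) - \<delta>) / sqrt (1 - (s x * (x - m) - \<delta>)\<^sup>2)) (at x)"
    proof -
      have "s x * (x - m) = \<bar>x - m\<bar>" using x by (auto simp: s_def)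
      then show ?thesis
        using u by (auto intro!: derivative_eq_intros simp: divide_simps)
    qed
    moreover have "s x * (x - m) = \<bar>x - m\<bar>" using x by (auto simp: s_def)
    moreover have "eventually (\<lambda>z. arc_profile \<delta> (z - m) = 1 - sqrt (1 - (s x * (z - m) - \<delta>)\<^sup>2)) (nhds x)"
      using ev
    proof eventually_elim
      case (elim z)
      then have "s x * (z - m) = \<bar>z - m\<bar>" by (auto simp: s_def split: if_splits)
      then show ?case using elim by (simp add: arc_profile_eq abs_le_iff)
    qed
    ultimately show "((\<lambda>x. arc_profile \<delta> (x - m)) has_real_derivative f' x) (at x)"
      by (subst DERIV_cong_ev[OF refl _ refl]) (auto simp: f'_def)
    have "1 + (f' x)\<^sup>2 = inverse (1 - (\<bar>x - m\<bar> - \<delta>)\<^sup>2)"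
    proof -
      have "(f' x)\<^sup>2 = (\<bar>x - m\<bar> - \<delta>)\<^sup>2 / (1 - (\<bar>x - m\<bar> - \<delta>)\<^sup>2)"
        using u s by (simp add: f'_def power_divide power_mult_distrib power2_eq_square[of "s x"])
      then show ?thesis using u by (simp add: field_simps)
    qed
    also have "\<dots> \<le> inverse (3 / 4)" using u by (intro le_imp_inverse_le) auto
    also have "\<dots> \<le> (29 / 25 :: real)\<^sup>2" by (simp add: power2_eq_square)
    finally show "sqrt (1 + (f' x)\<^sup>2) \<le> 29 / 25" by (rule real_le_lsqrt[rotated]) simp
  next
    show "((\<lambda>x. 29 / 25) has_integral 2 * \<delta> * 29 / 25) {m - \<delta>..m + \<delta>}"
      using has_integral_const_real[of "29 / 25 :: real" "m - \<delta>" "m + \<delta>"] \<delta> by simp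
  next
    show "arc_profile \<delta> (m - \<delta> - m) = 0" "arc_profile \<delta> (m + \<delta> - m) = 0"
      by (simp_all add: arc_profile_def)
  qed (use \<delta> in \<open>auto intro: continuous_on_arc_profile arc_profile_nonneg\<close>)
  then show ?thesis by (simp add: translate_lens)
qed

section \<open>Lengths and centres in the Cantor construction\<close>

text \<open>The length of each of the \<open>2 ^ n\<close> segments of stage \<open>n\<close>. The gap cut out of each has half-length
  \<open>1 / 2 ^ (2 * (n + 1))\<close> times the length \<open>2 ^ n * seg_length \<epsilon> n\<close> of the whole stage, that is,
  \<open>seg_length \<epsilon> n / 2 ^ (n + 2)\<close>.\<close>

primrec seg_length :: "real \<Rightarrow> nat \<Rightarrow> real" where
  "seg_length \<epsilon> 0 = 2 * \<epsilon>"
| "seg_length \<epsilon> (Suc n) = seg_length \<epsilon> n / 2 - seg_length \<epsilon> n / 2 ^ (n + 2)"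

definition gap_radius :: "real \<Rightarrow> nat \<Rightarrow> real" where
  "gap_radius \<epsilon> n = seg_length \<epsilon> n / 2 ^ (n + 2)"

primrec seg_centers :: "real \<Rightarrow> nat \<Rightarrow> real set" where
  "seg_centers \<epsilon> 0 = {0}"
| "seg_centers \<epsilon> (Suc n) =
     (\<Union>m\<in>seg_centers \<epsilon> n. {m - (seg_length \<epsilon> n / 4 + gap_radius \<epsilon> n / 2), m + (seg_length \<epsilon> n / 4 + gap_radius \<epsilon> n / 2)})"

text \<open>The projection of stage \<open>n\<close> to the first axis.\<close>

definition cantor_intervals :: "real \<Rightarrow> nat \<Rightarrow> real set" where
  "cantor_intervals \<epsilon> n = (\<Union>m\<in>seg_centers \<epsilon> n. cball m (seg_length \<epsilon> n / 2))"

lemma seg_length_Suc: "seg_length \<epsilon> (Suc n) = seg_length \<epsilon> n / 2 - gap_radius \<epsilon> n"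
  by (simp add: gap_radius_def)

declare seg_length.simps(2) [simp del]

lemma finite_seg_centers [simp]: "finite (seg_centers \<epsilon> n)"
  by (induction n) auto

context
  fixes \<epsilon> :: real
  assumes \<epsilon>: "0 < \<epsilon>"
begin

lemma seg_length_pos: "0 < seg_length \<epsilon> n"
proof (induction n)
  case (Suc n)
  have "(2::real) ^ 1 < 2 ^ (n + 2)" by (intro power_strict_increasing) auto
  then have "seg_length \<epsilon> n / 2 ^ (n + 2) < seg_length \<epsilon> n / 2"
    using Suc by (intro divide_strict_left_mono) auto
  then show ?case by (simp add: seg_length_Suc gap_radius_def)
qed (use \<epsilon> in auto)

lemma gap_radius_pos: "0 < gap_radius \<epsilon> n"
  using seg_length_pos by (simp add: gap_radius_def)

lemma gap_radius_less: "gap_radius \<epsilon> n < seg_length \<epsilon> n / 2"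
  using seg_length_pos[of "Suc n"] by (simp add: seg_length_Suc)

lemma seg_length_Suc_le: "seg_length \<epsilon> (Suc n) \<le> seg_length \<epsilon> n / 2"
  using gap_radius_pos[of n] by (simp add: seg_length_Suc)

lemma seg_length_le: "seg_length \<epsilon> n \<le> 2 * \<epsilon> / 2 ^ n"
proof (induction n)
  case (Suc n)
  then show ?case using seg_length_Suc_le[of n] by simp
qed simp

text \<open>Half of the initial segment is removed in the first step, so from then on the bound improves by
  a factor 2 on \<open>seg_length_le\<close>. This improvement is what makes the final comparison of constants
  work.\<close>

lemma seg_length_Suc_bound: "seg_length \<epsilon> (Suc n) \<le> \<epsilon> / 2 / 2 ^ n"
proof (induction n)
  case 0
  then show ?case by (simp add: seg_length_Suc gap_radius_def)
next
  case (Suc n)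
  then show ?case using seg_length_Suc_le[of "Suc n"] by simp
qed

lemma gap_radius_bound: "gap_radius \<epsilon> n \<le> \<epsilon> / 2 / 2 ^ n"
proof -
  have "gap_radius \<epsilon> n \<le> seg_length \<epsilon> n / 4"
    unfolding gap_radius_def using seg_length_pos[of n]
    by (intro divide_left_mono) auto
  then show ?thesis using seg_length_le[of n] by simp
qed

lemma seg_centers_separated:
  assumes "m \<in> seg_centers \<epsilon> n" "m' \<in> seg_centers \<epsilon> n" "m \<noteq> m'"
  shows "seg_length \<epsilon> n < \<bar>m - m'\<bar>"
  using assms
proof (induction n arbitrary: m m')
  case (Suc n)
  let ?l = "seg_length \<epsilon> n" and ?r = "gap_radius \<epsilon> n"
  note pos = seg_length_pos[of n] gap_radius_pos[of n] gap_radius_less[of n]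
  obtain p where p: "p \<in> seg_centers \<epsilon> n" "m = p - (?l / 4 + ?r / 2) \<or> m = p + (?l / 4 + ?r / 2)"
    using Suc.prems(1) by auto
  obtain p' where p': "p' \<in> seg_centers \<epsilon> n" "m' = p' - (?l / 4 + ?r / 2) \<or> m' = p' + (?l / 4 + ?r / 2)"
    using Suc.prems(2) by auto
  show ?case
  proof (cases "p = p'")
    case True
    then show ?thesis using p p' pos Suc.prems(3) by (auto simp: seg_length_Suc)
  next
    case False
    then have "?l < \<bar>p - p'\<bar>" using Suc.IH p p' by blast
    then show ?thesis using p(2) p'(2) pos by (auto simp: seg_length_Suc abs_if split: if_splits)
  qed
qed simp

text \<open>The segments of later stages stay outside the gaps removed earlier, expressed through
  centres only.\<close>

lemma seg_centers_avoid_gaps: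
  assumes "k < n" "c \<in> seg_centers \<epsilon> k" "m \<in> seg_centers \<epsilon> n"
  shows "gap_radius \<epsilon> k + seg_length \<epsilon> n / 2 \<le> \<bar>m - c\<bar>"
  using assms
proof (induction n arbitrary: m)
  case (Suc n)
  let ?l = "seg_length \<epsilon> n" and ?r = "gap_radius \<epsilon> n"
  note pos = seg_length_pos[of n] gap_radius_pos[of n] gap_radius_less[of n]
  obtain p where p: "p \<in> seg_centers \<epsilon> n" "m = p - (?l / 4 + ?r / 2) \<or> m = p + (?l / 4 + ?r / 2)"
    using Suc.prems(3) by auto
  then have mp: "\<bar>m - p\<bar> = ?l / 4 + ?r / 2" using pos by auto
  show ?case
  proof (cases "k = n")
    case True
    show ?thesis
    proof (cases "p = c")
      case True
      then show ?thesis using p pos \<open>k = n\<close> by (auto simp: seg_length_Suc field_simps)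
    next
      case False
      then have "?l < \<bar>p - c\<bar>" using seg_centers_separated p Suc.prems \<open>k = n\<close> by blast
      then have "?l - (?l / 4 + ?r / 2) < \<bar>m - c\<bar>" using mp by linarith
      then show ?thesis using pos by (simp add: seg_length_Suc \<open>k = n\<close> field_simps)
    qed
  next
    case False
    then have "gap_radius \<epsilon> k + ?l / 2 \<le> \<bar>p - c\<bar>" using Suc p by auto
    then have "gap_radius \<epsilon> k + ?l / 2 - (?l / 4 + ?r / 2) \<le> \<bar>m - c\<bar>" using mp by linarith
    then show ?thesis using pos by (simp add: seg_length_Suc field_simps)
  qed
qed simp

lemma card_seg_centers: "card (seg_centers \<epsilon> n) = 2 ^ n"
proof (induction n)
  case (Suc n)
  let ?s = "seg_length \<epsilon> n / 4 + gap_radius \<epsilon> n / 2"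
  let ?M = "seg_centers \<epsilon> n"
  note pos = seg_length_pos[of n] gap_radius_pos[of n] gap_radius_less[of n]
  have eq: "seg_centers \<epsilon> (Suc n) = (\<lambda>m. m - ?s) ` ?M \<union> (\<lambda>m. m + ?s) ` ?M" by auto
  have "(\<lambda>m. m - ?s) ` ?M \<inter> (\<lambda>m. m + ?s) ` ?M = {}"
  proof -
    have "m - ?s \<noteq> m' + ?s" if "m \<in> ?M" "m' \<in> ?M" for m m'
    proof
      assume "m - ?s = m' + ?s"
      then have "m - m' = 2 * ?s" by simp
      then show False using seg_centers_separated[OF that] pos by auto
    qed
    then show ?thesis by blast
  qed
  then have "card (seg_centers \<epsilon> (Suc n)) = card ((\<lambda>m. m - ?s) ` ?M) + card ((\<lambda>m. m + ?s) ` ?M)"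
    unfolding eq by (intro card_Un_disjoint) auto
  also have "card ((\<lambda>m. m - ?s) ` ?M) = card ?M" by (intro card_image) (auto simp: inj_on_def)
  also have "card ((\<lambda>m. m + ?s) ` ?M) = card ?M" by (intro card_image) (auto simp: inj_on_def)
  finally show ?case using Suc by simp
qed simp

text \<open>This links the recursion on centres and lengths with the removal of the middle segments.\<close>

lemma cantor_intervals_Suc:
  "cantor_intervals \<epsilon> (Suc n) =
     cantor_intervals \<epsilon> n - (\<Union>m\<in>seg_centers \<epsilon> n. ball m (gap_radius \<epsilon> n))"
proof (intro equalityI subsetI)
  let ?l = "seg_length \<epsilon> n" and ?r = "gap_radius \<epsilon> n"
  note pos = seg_length_pos[of n] gap_radius_pos[of n] gap_radius_less[of n]
  fix x assume "x \<in> cantor_intervals \<epsilon> (Suc n)"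
  then obtain m where m: "m \<in> seg_centers \<epsilon> (Suc n)" "\<bar>m - x\<bar> \<le> seg_length \<epsilon> (Suc n) / 2"
    by (auto simp: cantor_intervals_def dist_real_def simp del: seg_centers.simps)
  then obtain p where p: "p \<in> seg_centers \<epsilon> n" "m = p - (?l / 4 + ?r / 2) \<or> m = p + (?l / 4 + ?r / 2)"
    by auto
  have "\<bar>p - x\<bar> \<le> ?l / 2" using p(2) m(2) pos
    by (auto simp: seg_length_Suc abs_if split: if_splits)
  moreover have "?r \<le> \<bar>c - x\<bar>" if "c \<in> seg_centers \<epsilon> n" for c
    using seg_centers_avoid_gaps[OF lessI that m(1)] m(2) by linarith
  ultimately show "x \<in> cantor_intervals \<epsilon> n - (\<Union>m\<in>seg_centers \<epsilon> n. ball m (gap_radius \<epsilon> n))"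
    using p(1) by (fastforce simp: cantor_intervals_def dist_real_def)
next
  let ?l = "seg_length \<epsilon> n" and ?r = "gap_radius \<epsilon> n"
  fix x assume x: "x \<in> cantor_intervals \<epsilon> n - (\<Union>m\<in>seg_centers \<epsilon> n. ball m (gap_radius \<epsilon> n))"
  then obtain p where p: "p \<in> seg_centers \<epsilon> n" "\<bar>p - x\<bar> \<le> ?l / 2"
    by (auto simp: cantor_intervals_def dist_real_def)
  then have "?r \<le> \<bar>p - x\<bar>" using x by (auto simp: dist_real_def not_less)
  then have "\<bar>p - (?l / 4 + ?r / 2) - x\<bar> \<le> seg_length \<epsilon> (Suc n) / 2
      \<or> \<bar>p + (?l / 4 + ?r / 2) - x\<bar> \<le> seg_length \<epsilon> (Suc n) / 2"
    using p(2) by (auto simp: seg_length_Suc abs_if split: if_splits)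
  then show "x \<in> cantor_intervals \<epsilon> (Suc n)"
    using p(1) by (auto simp: cantor_intervals_def dist_real_def)
qed

text \<open>The construction needs this exact value, since it fixes the length of the segments
  removed in the next step. Above, the segments are cut into equal short pieces; below, the stage is projected to the
  axis.\<close>

lemma hausdorff1_cantor_intervals:
  "hausdorff1 ((\<lambda>x. (x, 0 :: real)) ` cantor_intervals \<epsilon> n) = ennreal (2 ^ n * seg_length \<epsilon> n)"
proof (rule antisym)
  let ?l = "seg_length \<epsilon> n" and ?M = "seg_centers \<epsilon> n"
  let ?A = "(\<lambda>x. (x, 0 :: real)) ` cantor_intervals \<epsilon> n"
  note l = seg_length_pos[of n]
  show "hausdorff1 ?A \<le> ennreal (2 ^ n * ?l)"
    unfolding hausdorff1_def
  proof (rule SUP_least)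
    fix d :: real assume "d \<in> {0<..}"
    then have d: "0 < d" by simp
    \<comment> \<open>Each segment is cut into \<open>k\<close> pieces of length \<open>h \<le> d\<close>.\<close>
    obtain k :: nat where k: "?l / d < k" using reals_Archimedean2 by blast
    then have k0: "0 < k" using l d by (metis divide_pos_pos gr0I less_asym of_nat_0)
    define h where "h = ?l / k"
    have h: "0 < h" "h \<le> d" "k * h = ?l"
      using k k0 d l by (auto simp: h_def field_simps)
    define V where "V = (\<lambda>(m, j :: nat). (\<lambda>x. (x, 0 :: real)) ` {m - ?l / 2 + j * h..m - ?l / 2 + (j + 1) * h})"
    have V: "bounded (V j) \<and> diameter (V j) \<le> h" for j
    proof -
      obtain m i where j: "j = (m, i)" by (cases j)
      have "dist x y \<le> h" if "x \<in> V j" "y \<in> V j" for x y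
        using that by (auto simp: V_def j dist_Pair_Pair dist_real_def abs_le_iff algebra_simps)
      then have "diameter (V j) \<le> h"
        using h(1) by (intro diameter_le) (auto simp: dist_norm)
      moreover have "bounded (V j)" unfolding V_def j
        by (auto intro!: compact_imp_bounded compact_continuous_image continuous_intros)
      ultimately show ?thesis by simp
    qed
    have "?A \<subseteq> (\<Union>j\<in>?M \<times> {..<k}. V j)"
    proof
      fix z assume "z \<in> ?A"
      then obtain x m where m: "z = (x, 0)" "m \<in> ?M" "\<bar>m - x\<bar> \<le> ?l / 2"
        by (auto simp: cantor_intervals_def dist_real_def)
      then have x: "m - ?l / 2 \<le> x" "x \<le> m + ?l / 2" by linarith+
      define t where "t = (x - (m - ?l / 2)) / h"
      have t: "0 \<le> t" "t \<le> k" "x = m - ?l / 2 + t * h"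
        using x h by (auto simp: t_def field_simps)
      obtain i where i: "i < k" "real i \<le> t" "t \<le> real i + 1"
      proof (cases "t = k")
        case True
        then show ?thesis using that[of "k - 1"] k0 by (simp add: of_nat_diff)
      next
        case False
        then have "nat \<lfloor>t\<rfloor> < k" using t by (simp add: nat_less_iff floor_less_iff)
        then show ?thesis using that[of "nat \<lfloor>t\<rfloor>"] t(1) by simp
      qed
      have "real i * h \<le> t * h" "t * h \<le> (real i + 1) * h"
        using i h(1) by (intro mult_right_mono; simp)+
      then have "z \<in> V (m, i)"
        using t(3) by (auto simp: V_def m(1))
      then show "z \<in> (\<Union>j\<in>?M \<times> {..<k}. V j)" using m(2) i(1) by blast
    qed
    then have "hausdorff1_pre d ?A \<le> (\<Sum>j\<in>?M \<times> {..<k}. ennreal (diameter (V j)))"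
      using V order_trans[OF _ h(2)] d by (intro hausdorff1_pre_le_finite_cover) auto
    also have "\<dots> \<le> (\<Sum>j\<in>?M \<times> {..<k}. ennreal h)"
      using V by (intro sum_mono ennreal_leI) auto
    also have "\<dots> = ennreal (2 ^ n * ?l)"
      using h by (simp add: card_seg_centers ennreal_of_nat_eq_real_of_nat ennreal_mult'[symmetric] mult.assoc)
    finally show "hausdorff1_pre d ?A \<le> ennreal (2 ^ n * ?l)" .
  qed
  have "ennreal (2 ^ n * ?l) = (\<Sum>m\<in>?M. emeasure lborel (cball m (?l / 2)))"
    using l by (simp add: card_seg_centers cball_eq_atLeastAtMost ennreal_of_nat_eq_real_of_nat
        ennreal_mult'[symmetric])
  also have "\<dots> = emeasure lborel (cantor_intervals \<epsilon> n)"
    unfolding cantor_intervals_def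
  proof (rule sum_emeasure)
    show "disjoint_family_on (\<lambda>m. cball m (?l / 2)) ?M"
      unfolding disjoint_family_on_def
    proof (intro ballI impI)
      fix m m' assume "m \<in> ?M" "m' \<in> ?M" "m \<noteq> m'"
      then have "?l < dist m m'" using seg_centers_separated by (auto simp: dist_real_def)
      then show "cball m (?l / 2) \<inter> cball m' (?l / 2) = {}"
        by (intro disjoint_cballI) simp
    qed
  qed auto
  also have "\<dots> \<le> hausdorff1 ?A"
    by (intro emeasure_fst_le_hausdorff1) (auto simp: cantor_intervals_def image_image)
  finally show "ennreal (2 ^ n * ?l) \<le> hausdorff1 ?A" .
qed

end

section \<open>The stages of the construction as sets of segments\<close>

text \<open>Each member is closed with closed complement in the union, so no connected set can leave it.\<close>

lemma components_Union_closed: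
  assumes "finite F" "\<And>C. C \<in> F \<Longrightarrow> closed C \<and> connected C \<and> C \<noteq> {}"
    and disj: "\<And>C D. C \<in> F \<Longrightarrow> D \<in> F \<Longrightarrow> C \<noteq> D \<Longrightarrow> C \<inter> D = {}"
  shows "components (\<Union>F) = F"
proof -
  have comp: "connected_component_set (\<Union>F) x = C" if "C \<in> F" "x \<in> C" for C x
  proof
    show "C \<subseteq> connected_component_set (\<Union>F) x"
      using that assms(2) by (intro connected_component_maximal) auto
    let ?K = "connected_component_set (\<Union>F) x"
    have "C \<inter> ?K = {} \<or> \<Union>(F - {C}) \<inter> ?K = {}"
    proof (rule connected_closedD)
      show "closed (\<Union>(F - {C}))" using assms(1,2) by (intro closed_Union) auto
      show "C \<inter> \<Union>(F - {C}) \<inter> ?K = {}" using disj that by blast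
      show "?K \<subseteq> C \<union> \<Union>(F - {C})" using connected_component_subset[of "\<Union>F" x] by blast
    qed (use that assms(2) in auto)
    moreover have "x \<in> ?K" using that by (auto intro: connected_component_refl)
    ultimately show "?K \<subseteq> C" using that connected_component_subset[of "\<Union>F" x] by blast
  qed
  show ?thesis
  proof (intro equalityI subsetI)
    fix K assume "K \<in> components (\<Union>F)"
    then show "K \<in> F" using comp by (auto simp: components_iff)
  next
    fix C assume C: "C \<in> F"
    then obtain x where "x \<in> C" using assms(2) by blast
    then show "C \<in> components (\<Union>F)" using C comp by (auto simp: components_iff)
  qed
qed

lemma image_cball_eq_segment:
  assumes "0 \<le> r"
  shows "(\<lambda>x. (x, 0 :: real)) ` cball m r = closed_segment (m - r, 0) (m + r, 0)"
proof -
  have "closed_segment (m - r, 0) (m + r, 0) = (\<lambda>x. (x, 0 :: real)) ` closed_segment (m - r) (m + r)"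
    by (rule closed_segment_linear_image[of "\<lambda>x. (x, 0 :: real)"])
       (auto intro!: linearI)
  then show ?thesis using assms by (simp add: cball_eq_atLeastAtMost closed_segment_eq_real_ivl)
qed

lemma image_ball_eq_segment:
  assumes "0 < r"
  shows "(\<lambda>x. (x, 0 :: real)) ` ball m r = open_segment ((m, 0) - (r, 0)) ((m, 0) + (r, 0))"
proof -
  have "open_segment (m - r, 0) (m + r, 0) = closed_segment (m - r, 0) (m + r, 0) - {(m - r, 0 :: real), (m + r, 0)}"
    by (simp add: open_segment_def)
  also have "\<dots> = (\<lambda>x. (x, 0 :: real)) ` (cball m r - {m - r, m + r})"
    using assms by (subst image_cball_eq_segment[symmetric]) auto
  also have "cball m r - {m - r, m + r} = ball m r"
    by (auto simp: dist_real_def abs_le_iff abs_less_iff)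
  finally show ?thesis by simp
qed

context
  fixes \<epsilon> :: real
  assumes \<epsilon>: "0 < \<epsilon>"
begin

text \<open>A segment determines the set of its end points and therefore its midpoint, in whichever order
  the end points are listed.\<close>

lemma segment_midpoints_cantor_intervals:
  "segment_midpoints ((\<lambda>x. (x, 0)) ` cantor_intervals \<epsilon> n) = (\<lambda>m. (m, 0)) ` seg_centers \<epsilon> n"
proof -
  let ?l = "seg_length \<epsilon> n"
  define seg where "seg m = closed_segment (m - ?l / 2, 0 :: real) (m + ?l / 2, 0 :: real)" for m
  note l = seg_length_pos[OF \<epsilon>, of n]
  have seg_eq: "seg m = (\<lambda>x. (x, 0 :: real)) ` cball m (?l / 2)" for m
    using l by (simp add: seg_def image_cball_eq_segment)
  have "(\<lambda>x. (x, 0 :: real)) ` cantor_intervals \<epsilon> n = \<Union>(seg ` seg_centers \<epsilon> n)"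
    by (auto simp: cantor_intervals_def seg_eq)
  moreover have "components (\<Union>(seg ` seg_centers \<epsilon> n)) = seg ` seg_centers \<epsilon> n"
  proof (rule components_Union_closed)
    fix C D assume "C \<in> seg ` seg_centers \<epsilon> n" "D \<in> seg ` seg_centers \<epsilon> n" "C \<noteq> D"
    then obtain m m' where m: "C = seg m" "D = seg m'" "m \<in> seg_centers \<epsilon> n" "m' \<in> seg_centers \<epsilon> n" "m \<noteq> m'"
      by auto
    then have "?l < dist m m'" using seg_centers_separated[OF \<epsilon>] by (auto simp: dist_real_def)
    then have "cball m (?l / 2) \<inter> cball m' (?l / 2) = {}" by (intro disjoint_cballI) simp
    then show "C \<inter> D = {}" unfolding m seg_eq by auto
  qed (auto simp: seg_def)
  moreover have "midpoint p q = (m, 0)" if "closed_segment p q = seg m" for p q m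
  proof -
    have "{p, q} = {(m - ?l / 2, 0), (m + ?l / 2, 0)}" using that by (simp add: seg_def)
    then have "p + q = (2 * m, 0)" by (auto simp: doubleton_eq_iff)
    then show ?thesis by (simp add: midpoint_def)
  qed
  moreover have "closed_segment (m - ?l / 2, 0) (m + ?l / 2, 0) = seg m" for m by (simp add: seg_def)
  ultimately show ?thesis
    unfolding segment_midpoints_def by (auto simp: image_iff) metis+
qed

lemma cantor_stage_eq: "cantor_stage \<epsilon> n = (\<lambda>x. (x, 0)) ` cantor_intervals \<epsilon> n"
proof (induction n)
  case 0
  show ?case using image_cball_eq_segment[of \<epsilon> 0] \<epsilon> by (simp add: cantor_intervals_def)
next
  case (Suc n)
  have r: "enn2real (hausdorff1 (cantor_stage \<epsilon> n)) / 2 ^ (2 * Suc n) = gap_radius \<epsilon> n"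
  proof -
    have "(2::real) ^ (2 * Suc n) = 2 ^ n * 2 ^ (n + 2)"
      by (simp add: power_add[symmetric] mult_2 del: power_Suc)
    then show ?thesis using seg_length_pos[OF \<epsilon>, of n]
      by (simp add: Suc hausdorff1_cantor_intervals[OF \<epsilon>] gap_radius_def del: power_Suc)
  qed
  have "cantor_stage \<epsilon> (Suc n) = cantor_stage \<epsilon> n -
      (\<Union>m\<in>segment_midpoints (cantor_stage \<epsilon> n). open_segment (m - (gap_radius \<epsilon> n, 0)) (m + (gap_radius \<epsilon> n, 0)))"
    by (simp only: cantor_stage.simps Let_def r)
  also have "\<dots> = (\<lambda>x. (x, 0)) ` cantor_intervals \<epsilon> n - (\<Union>m\<in>seg_centers \<epsilon> n. (\<lambda>x. (x, 0)) ` ball m (gap_radius \<epsilon> n))"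
    using gap_radius_pos[OF \<epsilon>, of n]
    by (simp add: Suc segment_midpoints_cantor_intervals image_ball_eq_segment)
  also have "\<dots> = (\<lambda>x. (x, 0)) ` cantor_intervals \<epsilon> (Suc n)"
    unfolding cantor_intervals_Suc[OF \<epsilon>] by auto
  finally show ?case .
qed

lemma cantor_delta_eq: "cantor_delta \<epsilon> (Suc n) = gap_radius \<epsilon> n"
proof -
  have "(2::real) ^ (2 * Suc n) = 2 ^ n * 2 ^ (n + 2)"
    by (simp add: power_add[symmetric] mult_2 del: power_Suc)
  then show ?thesis using seg_length_pos[OF \<epsilon>, of n]
    by (simp add: cantor_delta_def cantor_stage_eq hausdorff1_cantor_intervals[OF \<epsilon>] gap_radius_def del: power_Suc)
qed

lemma lens_union_eq:
  "lens_union \<epsilon> = (\<Union>n. \<Union>m\<in>seg_centers \<epsilon> n. (+) (m, 0) ` lens (gap_radius \<epsilon> n))"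
proof -
  have "{1..} = range Suc" by (auto simp: image_iff Suc_le_eq gr0_conv_Suc)
  then show ?thesis
    by (simp add: lens_union_def cantor_delta_eq cantor_stage_eq segment_midpoints_cantor_intervals
        image_image)
qed

end

section \<open>The lenses and the upper bound for the perimeter\<close>

text \<open>Consequently, every lens lies in the closed ball of radius \<open>\<delta>\<close> around its centre.\<close>

lemma arc_profile_le:
  assumes "\<bar>x\<bar> \<le> \<delta>" "\<delta> \<le> 1"
  shows "arc_profile \<delta> x \<le> \<delta> - \<bar>x\<bar>"
proof -
  define s where "s = \<delta> - \<bar>x\<bar>"
  have s: "0 \<le> s" "s \<le> 1" using assms by (auto simp: s_def)
  have "(1 - s)\<^sup>2 \<le> 1 - s\<^sup>2" using s mult_left_mono[of s 1 s] by (simp add: power2_eq_square algebra_simps)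
  then have "1 - s \<le> sqrt (1 - s\<^sup>2)" by (rule real_le_rsqrt)
  moreover have "(\<bar>x\<bar> - \<delta>)\<^sup>2 = s\<^sup>2" by (simp add: s_def power2_commute)
  ultimately show ?thesis using assms by (simp add: arc_profile_eq s_def)
qed

text \<open>Away from the end points of a lens its height is bounded below, independently of the
  lens. This keeps the upper and the lower arcs apart from each other and from the axis.\<close>

lemma arc_profile_ge:
  assumes "\<eta> \<le> \<delta> - \<bar>x\<bar>" "0 \<le> \<eta>" "\<delta> \<le> 1"
  shows "1 - sqrt (1 - \<eta>\<^sup>2) \<le> arc_profile \<delta> x"
proof -
  have "(\<delta> - \<bar>x\<bar>)\<^sup>2 \<ge> \<eta>\<^sup>2" using assms by (intro power_mono) auto
  then show ?thesis using assms by (simp add: arc_profile_eq power2_commute[of _ \<delta>])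
qed

definition lens_level :: "real \<Rightarrow> nat \<Rightarrow> (real \<times> real) set" where
  "lens_level \<epsilon> n = (\<Union>m\<in>seg_centers \<epsilon> n. (+) (m, 0) ` lens (gap_radius \<epsilon> n))"

lemma compact_translate_lens: "compact ((+) (m, 0) ` lens \<delta>)"
  unfolding translate_lens by (intro compact_profile_region continuous_on_arc_profile)

lemma mem_translate_lens:
  "(x, y) \<in> (+) (m, 0) ` lens \<delta> \<longleftrightarrow> \<bar>x - m\<bar> \<le> \<delta> \<and> \<bar>y\<bar> \<le> arc_profile \<delta> (x - m)"
  unfolding translate_lens by (auto simp: profile_region_def abs_le_iff)

lemma compact_lens_level: "compact (lens_level \<epsilon> n)"
  unfolding lens_level_def by (intro compact_UN compact_translate_lens) auto

context
  fixes \<epsilon> :: real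
  assumes \<epsilon>: "0 < \<epsilon>" "\<epsilon> < 1"
begin

lemma lens_union_levels: "lens_union \<epsilon> = (\<Union>n. lens_level \<epsilon> n)"
  using \<epsilon> by (simp add: lens_union_eq lens_level_def)

lemma gap_radius_le_half: "gap_radius \<epsilon> n \<le> 1 / 2"
proof -
  have "\<epsilon> / 2 / 2 ^ n \<le> \<epsilon> / 2 / 1" using \<epsilon> by (intro divide_left_mono) auto
  then show ?thesis using gap_radius_bound[of \<epsilon> n] \<epsilon> by simp
qed

text \<open>Even the closed gaps are pairwise disjoint, which makes distinct lenses disjoint as well.\<close>

lemma gaps_separated:
  assumes "(k, m) \<noteq> (n, m')" "m \<in> seg_centers \<epsilon> k" "m' \<in> seg_centers \<epsilon> n"
  shows "gap_radius \<epsilon> k + gap_radius \<epsilon> n < \<bar>m - m'\<bar>"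
proof -
  have *: "gap_radius \<epsilon> k + gap_radius \<epsilon> n < \<bar>c - c'\<bar>"
    if "k < n" "c \<in> seg_centers \<epsilon> k" "c' \<in> seg_centers \<epsilon> n" for k n c c'
    using seg_centers_avoid_gaps[OF \<epsilon>(1) that] gap_radius_less[OF \<epsilon>(1), of n] by linarith
  consider "k < n" | "n < k" | "k = n" by linarith
  then show ?thesis
  proof cases
    case 3
    then have "seg_length \<epsilon> n < \<bar>m - m'\<bar>" using assms seg_centers_separated[OF \<epsilon>(1)] by auto
    then show ?thesis using gap_radius_less[OF \<epsilon>(1), of n] 3 by simp
  qed (use *[OF _ assms(2,3)] *[OF _ assms(3,2)] in auto)
qed

lemma seg_centers_bound:
  assumes "m \<in> seg_centers \<epsilon> n"
  shows "\<bar>m\<bar> + seg_length \<epsilon> n / 2 \<le> \<epsilon>"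
  using assms
proof (induction n arbitrary: m)
  case (Suc n)
  let ?s = "seg_length \<epsilon> n / 4 + gap_radius \<epsilon> n / 2"
  have "0 < ?s" using seg_length_pos[OF \<epsilon>(1), of n] gap_radius_pos[OF \<epsilon>(1), of n] by simp
  moreover obtain p where p: "p \<in> seg_centers \<epsilon> n" "m = p - ?s \<or> m = p + ?s"
    using Suc.prems by auto
  ultimately have "\<bar>m\<bar> \<le> \<bar>p\<bar> + ?s" by auto
  then show ?case using Suc.IH[OF p(1)] by (simp add: seg_length_Suc field_simps)
qed simp

lemma lens_union_subset_cball: "closure (lens_union \<epsilon>) \<subseteq> cball 0 \<epsilon>"
proof (rule closure_minimal)
  show "lens_union \<epsilon> \<subseteq> cball 0 \<epsilon>"
  proof
    fix p assume "p \<in> lens_union \<epsilon>"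
    then obtain n m x y where m: "p = (x, y)" "m \<in> seg_centers \<epsilon> n" "(x, y) \<in> (+) (m, 0) ` lens (gap_radius \<epsilon> n)"
      by (cases p) (auto simp: lens_union_levels lens_level_def)
    then have "\<bar>x - m\<bar> \<le> gap_radius \<epsilon> n" "\<bar>y\<bar> \<le> arc_profile (gap_radius \<epsilon> n) (x - m)"
      by (auto simp: mem_translate_lens)
    then have "\<bar>x - m\<bar> + \<bar>y\<bar> \<le> gap_radius \<epsilon> n"
      using arc_profile_le[of "x - m" "gap_radius \<epsilon> n"] gap_radius_le_half[of n] by linarith
    then have "\<bar>x\<bar> + \<bar>y\<bar> \<le> \<epsilon>"
      using seg_centers_bound[OF m(2)] gap_radius_less[OF \<epsilon>(1), of n] by linarith
    then show "p \<in> cball 0 \<epsilon>" using norm_Pair_le[of x y] m(1) by auto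
  qed
qed simp

text \<open>At a given height above the axis only finitely many lenses occur, and these are closed.\<close>

lemma closure_lens_union_off_axis:
  assumes "(x, y) \<in> closure (lens_union \<epsilon>)" "y \<noteq> 0"
  shows "(x, y) \<in> lens_union \<epsilon>"
proof -
  obtain N where N: "\<epsilon> / 2 * (1 / 2) ^ N < \<bar>y\<bar>"
  proof -
    have "(\<lambda>N. \<epsilon> / 2 * (1 / 2) ^ N) \<longlonglongrightarrow> \<epsilon> / 2 * 0" by (intro tendsto_intros LIMSEQ_power_zero) simp
    then have "eventually (\<lambda>N. \<epsilon> / 2 * (1 / 2) ^ N < \<bar>y\<bar>) sequentially"
      by (rule order_tendstoD) (use assms(2) in simp)
    then show ?thesis using that by (auto simp: eventually_sequentially)
  qed
  let ?K = "(\<Union>n<N. lens_level \<epsilon> n) \<union> {p. \<bar>snd p\<bar> \<le> \<epsilon> / 2 * (1 / 2) ^ N}"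
  have "closure (lens_union \<epsilon>) \<subseteq> ?K"
  proof (rule closure_minimal)
    show "lens_union \<epsilon> \<subseteq> ?K"
    proof
      fix p assume "p \<in> lens_union \<epsilon>"
      then obtain n where n: "p \<in> lens_level \<epsilon> n" by (auto simp: lens_union_levels)
      show "p \<in> ?K"
      proof (cases "n < N")
        case False
        obtain m x y where m: "p = (x, y)" "(x, y) \<in> (+) (m, 0) ` lens (gap_radius \<epsilon> n)"
          using n by (cases p) (auto simp: lens_level_def)
        then have "\<bar>y\<bar> \<le> gap_radius \<epsilon> n"
          using arc_profile_le[of "x - m" "gap_radius \<epsilon> n"] gap_radius_le_half[of n]
          by (auto simp: mem_translate_lens)
        also have "\<dots> \<le> \<epsilon> / 2 * (1 / 2) ^ n"
          using gap_radius_bound[OF \<epsilon>(1), of n] by (simp add: power_one_over)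
        also have "\<dots> \<le> \<epsilon> / 2 * (1 / 2) ^ N"
          using False \<epsilon> by (intro mult_left_mono power_decreasing) auto
        finally show ?thesis by (simp add: m)
      qed (use n in auto)
    qed
    show "closed ?K"
      by (intro closed_Un closed_UN ballI closed_Collect_le continuous_intros
          compact_imp_closed[OF compact_lens_level]) auto
  qed
  then show ?thesis using assms N by (force simp: lens_union_levels)
qed

lemma level_gap_length: "2 ^ n * (2 * gap_radius \<epsilon> n) = seg_length \<epsilon> n / 2"
  by (simp add: gap_radius_def)

lemma summable_seg_length: "summable (seg_length \<epsilon>)"
proof (rule summable_comparison_test')
  show "summable (\<lambda>n. 2 * \<epsilon> * (1 / 2) ^ n)" by (intro summable_mult summable_geometric) simp
  show "norm (seg_length \<epsilon> n) \<le> 2 * \<epsilon> * (1 / 2) ^ n" for n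
    using seg_length_le[OF \<epsilon>(1), of n] seg_length_pos[OF \<epsilon>(1), of n] by (simp add: power_one_over)
qed

lemma half_seg_length_nonneg: "0 \<le> seg_length \<epsilon> n / 2"
  using seg_length_pos[OF \<epsilon>(1), of n] by simp

lemma total_gap_length_nonneg: "0 \<le> (\<Sum>n. seg_length \<epsilon> n / 2)"
  by (intro suminf_nonneg summable_divide summable_seg_length half_seg_length_nonneg)

text \<open>The first gap has length \<open>\<epsilon>\<close>. The gaps of step \<open>n + 2\<close> together have length
  \<open>seg_length \<epsilon> (n + 1) / 2\<close>, which is at most \<open>\<epsilon> / 4 / 2 ^ n\<close>.\<close>

lemma total_gap_length_le: "(\<Sum>n. seg_length \<epsilon> n / 2) \<le> 3 / 2 * \<epsilon>"
proof -
  have s: "summable (\<lambda>n. seg_length \<epsilon> n / 2)" by (intro summable_divide summable_seg_length)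
  have "(\<Sum>n. seg_length \<epsilon> (Suc n) / 2) \<le> (\<Sum>n. \<epsilon> / 4 * (1 / 2) ^ n)"
  proof (rule suminf_le)
    show "seg_length \<epsilon> (Suc n) / 2 \<le> \<epsilon> / 4 * (1 / 2) ^ n" for n
      using seg_length_Suc_bound[OF \<epsilon>(1), of n] by (simp add: power_one_over)
    show "summable (\<lambda>n. seg_length \<epsilon> (Suc n) / 2)" using s by (rule summable_Suc_iff[THEN iffD2])
  qed (intro summable_mult summable_geometric, simp)
  also have "\<dots> = \<epsilon> / 2" by (subst suminf_mult) (auto simp: suminf_geometric summable_geometric)
  finally show ?thesis using suminf_split_head[OF s] by simp
qed

lemma abs_divergence_integral_lens_level_le:
  assumes \<phi>: "C1_field \<phi>" "\<And>p. norm (\<phi> p) \<le> 1"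
  shows "\<bar>set_lebesgue_integral lebesgue (lens_level \<epsilon> n) (divergence \<phi>)\<bar> \<le> 58 / 25 * (seg_length \<epsilon> n / 2)"
proof -
  let ?L = "\<lambda>m. (+) (m, 0 :: real) ` lens (gap_radius \<epsilon> n)"
  have "set_lebesgue_integral lebesgue (lens_level \<epsilon> n) (divergence \<phi>)
      = (\<Sum>m\<in>seg_centers \<epsilon> n. set_lebesgue_integral lebesgue (?L m) (divergence \<phi>))"
    unfolding lens_level_def
  proof (rule set_integral_finite_Union)
    show "disjoint_family_on ?L (seg_centers \<epsilon> n)"
      unfolding disjoint_family_on_def
    proof (intro ballI impI)
      fix m m' assume "m \<in> seg_centers \<epsilon> n" "m' \<in> seg_centers \<epsilon> n" "m \<noteq> m'"
      then have "gap_radius \<epsilon> n + gap_radius \<epsilon> n < \<bar>m - m'\<bar>" by (intro gaps_separated) auto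
      then show "?L m \<inter> ?L m' = {}"
        by (force simp: mem_translate_lens disjoint_iff simp del: image_iff)
    qed
    show "set_integrable lebesgue (?L m) (divergence \<phi>)" for m
      by (intro divergence_integral_lborel \<phi> compact_translate_lens)
    show "?L m \<in> sets lebesgue" for m
      by (intro lmeasurable_compact fmeasurableD compact_translate_lens)
  qed simp
  also have "\<bar>\<dots>\<bar> \<le> (\<Sum>m\<in>seg_centers \<epsilon> n. \<bar>set_lebesgue_integral lebesgue (?L m) (divergence \<phi>)\<bar>)"
    by (rule sum_abs)
  also have "\<dots> \<le> (\<Sum>m\<in>seg_centers \<epsilon> n. 116 / 25 * gap_radius \<epsilon> n)"
    using gap_radius_pos[OF \<epsilon>(1), of n] gap_radius_le_half[of n]
    by (intro sum_mono abs_divergence_integral_lens_le \<phi>) auto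
  also have "\<dots> = 58 / 25 * (2 ^ n * (2 * gap_radius \<epsilon> n))" by (simp add: card_seg_centers[OF \<epsilon>(1)])
  finally show ?thesis by (simp only: level_gap_length)
qed

lemma lens_levels_disjoint:
  assumes "k \<noteq> n"
  shows "lens_level \<epsilon> k \<inter> lens_level \<epsilon> n = {}"
proof -
  have False if p: "(x, y) \<in> lens_level \<epsilon> k" "(x, y) \<in> lens_level \<epsilon> n" for x y
  proof -
    obtain m m' where m: "m \<in> seg_centers \<epsilon> k" "(x, y) \<in> (+) (m, 0) ` lens (gap_radius \<epsilon> k)"
        "m' \<in> seg_centers \<epsilon> n" "(x, y) \<in> (+) (m', 0) ` lens (gap_radius \<epsilon> n)"
      using p unfolding lens_level_def by blast
    then have "\<bar>x - m\<bar> \<le> gap_radius \<epsilon> k" "\<bar>x - m'\<bar> \<le> gap_radius \<epsilon> n"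
      unfolding mem_translate_lens by auto
    moreover have "gap_radius \<epsilon> k + gap_radius \<epsilon> n < \<bar>m - m'\<bar>" using m assms by (intro gaps_separated) auto
    ultimately show False by linarith
  qed
  then show ?thesis by auto
qed

text \<open>Up to a null set, the closed disc is the disjoint union of \<^term>\<open>Omega \<epsilon>\<close> and the lenses. The
  divergence integral over the lenses enters with a minus sign, which the absolute values in the
  estimates absorb.\<close>

lemma perimeter_Omega_le:
  "perimeter (Omega \<epsilon>) \<le> ennreal (2 * pi + 58 / 25 * (\<Sum>n. seg_length \<epsilon> n / 2))"
  unfolding perimeter_def
proof (rule SUP_least, rule ennreal_leI)
  fix \<phi> :: "real \<times> real \<Rightarrow> real \<times> real"
  assume "\<phi> \<in> perimeter_test_fields"
  then have \<phi>: "C1_field \<phi>" "\<And>p. norm (\<phi> p) \<le> 1" by (auto simp: perimeter_test_fields_def)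
  let ?F = "lens_union \<epsilon>"
  let ?I = "\<lambda>A. set_lebesgue_integral lebesgue A (divergence \<phi>)"
  have F: "?F \<subseteq> cball 0 1" "closure ?F \<subseteq> ball 0 1"
    using lens_union_subset_cball closure_subset[of ?F] \<epsilon> by (fastforce simp: subset_iff)+
  have meas_level: "lens_level \<epsilon> n \<in> sets lebesgue" for n
    by (intro lmeasurable_compact fmeasurableD compact_lens_level)
  have meas_F: "?F \<in> sets lebesgue"
    unfolding lens_union_levels using meas_level by (intro sets.countable_UN) auto
  have meas_Omega: "Omega \<epsilon> \<in> sets lebesgue" by (simp add: open_Omega)
  have intg: "set_integrable lebesgue A (divergence \<phi>)" if "A \<in> sets lebesgue" "A \<subseteq> cball 0 1" for A
    using divergence_integral_lborel(1)[OF \<phi>(1) compact_cball] that by (rule set_integrable_subset)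
  have Omega: "Omega \<epsilon> \<subseteq> cball 0 1" by (auto simp: Omega_def)
  have disj: "Omega \<epsilon> \<inter> ?F = {}" using closure_subset[of ?F] by (auto simp: Omega_def)
  have "?I (cball 0 1) = ?I (Omega \<epsilon> \<union> ?F)"
  proof (rule set_integral_cong_set)
    have "negligible ({p :: real \<times> real. (0, 1) \<bullet> p = 0} \<union> sphere 0 1)"
      by (intro negligible_Un negligible_hyperplane negligible_sphere) (simp add: zero_prod_def)
    then have "AE p in lebesgue. p \<notin> {p :: real \<times> real. (0, 1) \<bullet> p = 0} \<union> sphere 0 1"
      by (intro AE_not_in) (simp add: negligible_iff_null_sets)
    then show "AE p in lebesgue. p \<in> Omega \<epsilon> \<union> ?F \<longleftrightarrow> p \<in> cball 0 1"
    proof eventually_elim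
      case (elim p)
      obtain x y where p: "p = (x, y)" by (cases p)
      show ?case
        using elim F Omega closure_lens_union_off_axis[of x y]
        by (auto simp: Omega_def p inner_prod_def)
    qed
  qed (use intg[of "cball 0 1"] intg[of "Omega \<epsilon> \<union> ?F"] meas_F meas_Omega F Omega in
      \<open>auto simp: set_borel_measurable_def set_integrable_def\<close>)
  also have "\<dots> = ?I (Omega \<epsilon>) + ?I ?F"
    using disj by (intro set_integral_Un intg meas_F meas_Omega F Omega)
  finally have "?I (Omega \<epsilon>) = ?I (cball 0 1) - ?I ?F" by simp
  moreover have "?I (cball 0 1) \<le> 2 * pi"
    using abs_divergence_integral_disc_le[OF \<phi>] by simp
  moreover have "\<bar>?I ?F\<bar> \<le> 58 / 25 * (\<Sum>n. seg_length \<epsilon> n / 2)"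
  proof -
    have "?I ?F = (\<Sum>n. ?I (lens_level \<epsilon> n))"
      unfolding lens_union_levels
      using intg[OF meas_F F(1)] lens_levels_disjoint meas_level
      by (intro lebesgue_integral_countable_add) (auto simp: lens_union_levels)
    also have "norm \<dots> \<le> (\<Sum>n. 58 / 25 * (seg_length \<epsilon> n / 2))"
      using abs_divergence_integral_lens_level_le[OF \<phi>]
      by (intro norm_suminf_le summable_mult summable_divide summable_seg_length) auto
    also have "\<dots> = 58 / 25 * (\<Sum>n. seg_length \<epsilon> n / 2)"
      by (intro suminf_mult summable_divide summable_seg_length)
    finally show ?thesis by simp
  qed
  ultimately show "?I (Omega \<epsilon>) \<le> 2 * pi + 58 / 25 * (\<Sum>n. seg_length \<epsilon> n / 2)" by linarith
qed

end

section \<open>The lower bound for the length of the boundary\<close>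

lemma dist_unit_circle: "dist (cos s, sin s) (cos t, sin t) = 2 * \<bar>sin ((s - t) / 2)\<bar>"
proof -
  have "(cos s - cos t)\<^sup>2 + (sin s - sin t)\<^sup>2 = 2 - 2 * cos (s - t)"
    using sin_cos_squared_add[of s] sin_cos_squared_add[of t]
    by (simp add: power2_eq_square cos_diff algebra_simps)
  also have "cos (s - t) = 1 - 2 * (sin ((s - t) / 2))\<^sup>2"
  proof -
    have "2 * ((s - t) / 2) = s - t" by simp
    then show ?thesis using cos_double_sin[of "(s - t) / 2"] by metis
  qed
  finally have "(cos s - cos t)\<^sup>2 + (sin s - sin t)\<^sup>2 = (2 * \<bar>sin ((s - t) / 2)\<bar>)\<^sup>2"
    by (simp add: power_mult_distrib)
  then show ?thesis
    unfolding dist_Pair_Pair dist_real_def power2_abs by (metis real_sqrt_abs abs_mult abs_idempotent abs_numeral)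
qed

text \<open>The angular parametrisation is restricted to \<open>{- (pi - \<theta>)..pi - \<theta>}\<close>. There, two points at
  distance at most \<open>sin \<theta>\<close> have parameters that differ by less than \<open>2 \<theta>\<close>, and for such points chord
  and arc differ at most by the factor \<open>cos \<theta>\<close>. Then \<open>\<theta>\<close> tends to 0.\<close>

lemma hausdorff1_unit_circle_ge: "ennreal (2 * pi) \<le> hausdorff1 (sphere 0 1 :: (real \<times> real) set)"
proof -
  let ?H = "hausdorff1 (sphere 0 1 :: (real \<times> real) set)"
  have bound: "ennreal (cos \<theta> * (2 * (pi - \<theta>))) \<le> ?H" if \<theta>: "0 < \<theta>" "\<theta> < pi / 2" for \<theta>
  proof -
    let ?S = "{- (pi - \<theta>)..pi - \<theta>}"
    have c: "0 < cos \<theta>" using \<theta> by (intro cos_gt_zero) auto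
    have s: "0 < sin \<theta>" using \<theta> pi_gt_zero by (intro sin_gt_zero) auto
    have "emeasure lborel {- (pi - \<theta>)..pi - \<theta>} \<le> ennreal (1 / cos \<theta>) * ?H"
    proof (rule emeasure_le_hausdorff1[where \<gamma> = "\<lambda>t. (cos t, sin t)" and d = "sin \<theta>"])
      fix a b assume ab: "a \<in> {- (pi - \<theta>)..pi - \<theta>}" "b \<in> {- (pi - \<theta>)..pi - \<theta>}"
        and d: "dist (cos a, sin a) (cos b, sin b) \<le> sin \<theta>"
      define u where "u = \<bar>a - b\<bar> / 2"
      have u: "0 \<le> u" "u \<le> pi - \<theta>" using ab by (auto simp: u_def)
      have "\<bar>sin ((a - b) / 2)\<bar> = sin u"
      proof -
        have "u = (a - b) / 2 \<or> u = - ((a - b) / 2)" unfolding u_def by linarith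
        then have "sin u = sin ((a - b) / 2) \<or> sin u = - sin ((a - b) / 2)" by (metis sin_minus)
        moreover have "0 \<le> sin u" using u \<theta> by (intro sin_ge_zero) auto
        ultimately show ?thesis by linarith
      qed
      then have D: "dist (cos a, sin a) (cos b, sin b) = 2 * sin u" by (simp add: dist_unit_circle)
      have "u < \<theta>"
      proof (rule ccontr)
        assume "\<not> u < \<theta>"
        have "sin \<theta> \<le> sin u"
        proof (cases "u \<le> pi / 2")
          case True
          then show ?thesis using \<open>\<not> u < \<theta>\<close> \<theta> by (intro sin_monotone_2pi_le) auto
        next
          case False
          then have "sin \<theta> \<le> sin (pi - u)" using u \<theta> by (intro sin_monotone_2pi_le) auto
          then show ?thesis by simp
        qed
        then show False using d s D by simp
      qed
      have "u * cos \<theta> \<le> sin u"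
      proof -
        have "sin 0 - 0 * cos \<theta> \<le> sin u - u * cos \<theta>"
        proof (rule DERIV_nonneg_imp_nondecreasing[OF u(1)])
          fix v assume v: "0 \<le> v" "v \<le> u"
          then have "cos \<theta> \<le> cos v" using \<open>u < \<theta>\<close> \<theta> by (intro cos_monotone_0_pi_le) auto
          moreover have "((\<lambda>v. sin v - v * cos \<theta>) has_real_derivative cos v - cos \<theta>) (at v)"
            by (auto intro!: derivative_eq_intros)
          ultimately show "\<exists>d. ((\<lambda>v. sin v - v * cos \<theta>) has_real_derivative d) (at v) \<and> 0 \<le> d"
            by (intro exI[of _ "cos v - cos \<theta>"]) simp
        qed
        then show ?thesis by simp
      qed
      then show "\<bar>a - b\<bar> \<le> 1 / cos \<theta> * dist (cos a, sin a) (cos b, sin b)"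
        unfolding D using c by (simp add: u_def field_simps)
    qed (use c s in \<open>auto simp: norm_Pair\<close>)
    moreover have "emeasure lborel {- (pi - \<theta>)..pi - \<theta>} = ennreal (2 * (pi - \<theta>))"
      using \<theta> by simp
    ultimately have "ennreal (cos \<theta>) * ennreal (2 * (pi - \<theta>)) \<le> ennreal (cos \<theta>) * (ennreal (1 / cos \<theta>) * ?H)"
      by (intro mult_left_mono) auto
    also have "\<dots> = ?H" using c by (simp add: mult.assoc[symmetric] ennreal_mult'[symmetric])
    finally show ?thesis using c by (simp add: ennreal_mult')
  qed
  have "((\<lambda>\<theta>. ennreal (cos \<theta> * (2 * (pi - \<theta>)))) \<longlongrightarrow> ennreal (cos 0 * (2 * (pi - 0)))) (at_right 0)"
    by (intro tendsto_ennrealI tendsto_intros)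
  moreover have "eventually (\<lambda>\<theta>. ennreal (cos \<theta> * (2 * (pi - \<theta>))) \<le> ?H) (at_right 0)"
    unfolding eventually_at_right_field using bound by (intro exI[of _ "pi / 2"]) auto
  ultimately have "ennreal (cos 0 * (2 * (pi - 0))) \<le> ?H"
    by (rule tendsto_upperbound) simp
  then show ?thesis by simp
qed

definition cantor_set :: "real \<Rightarrow> real set" where
  "cantor_set \<epsilon> = (\<Inter>n. cantor_intervals \<epsilon> n)"

text \<open>The gaps shortened by \<open>\<eta>\<close> at both ends, where balls of negative radius are empty. Above these points the lenses have a height
  that is bounded below.\<close>

definition shortened_gaps :: "real \<Rightarrow> real \<Rightarrow> real set" where
  "shortened_gaps \<epsilon> \<eta> = (\<Union>n. \<Union>m\<in>seg_centers \<epsilon> n. cball m (gap_radius \<epsilon> n - \<eta>))"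

context
  fixes \<epsilon> :: real
  assumes \<epsilon>: "0 < \<epsilon>" "\<epsilon> < 1"
begin

lemma cantor_set_eq_Diff:
  "cantor_set \<epsilon> = {- \<epsilon>..\<epsilon>} - (\<Union>n. \<Union>m\<in>seg_centers \<epsilon> n. ball m (gap_radius \<epsilon> n))"
proof -
  have "cantor_intervals \<epsilon> n = {- \<epsilon>..\<epsilon>} - (\<Union>k<n. \<Union>m\<in>seg_centers \<epsilon> k. ball m (gap_radius \<epsilon> k))" for n
  proof (induction n)
    case 0
    show ?case by (simp add: cantor_intervals_def cball_eq_atLeastAtMost)
  next
    case (Suc n)
    then show ?case by (auto simp: cantor_intervals_Suc[OF \<epsilon>(1)] less_Suc_eq)
  qed
  moreover have "(\<Inter>n. A - (\<Union>k<n. B k)) = A - (\<Union>n. B n)" for A :: "real set" and B :: "nat \<Rightarrow> real set"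
    using lessI by blast
  ultimately show ?thesis unfolding cantor_set_def by simp
qed

lemma gaps_subset: "(\<Union>n. \<Union>m\<in>seg_centers \<epsilon> n. ball m (gap_radius \<epsilon> n)) \<subseteq> {- \<epsilon>..\<epsilon>}"
proof clarify
  fix n m x assume m: "m \<in> seg_centers \<epsilon> n" "x \<in> ball m (gap_radius \<epsilon> n)"
  then have "\<bar>m - x\<bar> < gap_radius \<epsilon> n" by (simp add: dist_real_def)
  then have "\<bar>x\<bar> \<le> \<epsilon>" using seg_centers_bound[OF \<epsilon> m(1)] gap_radius_less[OF \<epsilon>(1), of n] by linarith
  then show "x \<in> {- \<epsilon>..\<epsilon>}" by auto
qed

lemma emeasure_gaps:
  "emeasure lborel (\<Union>n. \<Union>m\<in>seg_centers \<epsilon> n. ball m (gap_radius \<epsilon> n)) = ennreal (\<Sum>n. seg_length \<epsilon> n / 2)"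
proof -
  let ?G = "\<lambda>n. \<Union>m\<in>seg_centers \<epsilon> n. ball m (gap_radius \<epsilon> n)"
  have disj: "ball m (gap_radius \<epsilon> k) \<inter> ball m' (gap_radius \<epsilon> n) = {}"
    if "(k, m) \<noteq> (n, m')" "m \<in> seg_centers \<epsilon> k" "m' \<in> seg_centers \<epsilon> n" for k n m m'
    using gaps_separated[OF \<epsilon> that] by (intro disjoint_ballI) (simp add: dist_real_def)
  have "emeasure lborel (?G n) = ennreal (seg_length \<epsilon> n / 2)" for n
  proof -
    have "emeasure lborel (?G n) = (\<Sum>m\<in>seg_centers \<epsilon> n. emeasure lborel (ball m (gap_radius \<epsilon> n)))"
      using disj[of n _ n] by (intro sum_emeasure[symmetric]) (auto simp: disjoint_family_on_def)
    also have "\<dots> = (\<Sum>m\<in>seg_centers \<epsilon> n. ennreal (2 * gap_radius \<epsilon> n))"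
      using gap_radius_pos[OF \<epsilon>(1), of n] by (simp add: ball_eq_greaterThanLessThan)
    also have "\<dots> = ennreal (2 ^ n * (2 * gap_radius \<epsilon> n))"
      by (simp add: card_seg_centers[OF \<epsilon>(1)] ennreal_of_nat_eq_real_of_nat ennreal_mult'[symmetric])
    finally show ?thesis by (simp only: level_gap_length[OF \<epsilon>])
  qed
  moreover have "(\<Sum>n. emeasure lborel (?G n)) = emeasure lborel (\<Union>n. ?G n)"
  proof (rule suminf_emeasure)
    show "disjoint_family ?G"
      unfolding disjoint_family_on_def
    proof (intro ballI impI)
      fix k n :: nat assume "k \<noteq> n"
      then show "?G k \<inter> ?G n = {}" using disj[of k _ n] by blast
    qed
  qed auto
  moreover have "(\<Sum>n. ennreal (seg_length \<epsilon> n / 2)) = ennreal (\<Sum>n. seg_length \<epsilon> n / 2)"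
    by (intro suminf_ennreal2 summable_divide summable_seg_length[OF \<epsilon>] half_seg_length_nonneg[OF \<epsilon>])
  ultimately show ?thesis by simp
qed

lemma emeasure_cantor_set:
  "emeasure lborel (cantor_set \<epsilon>) + ennreal (\<Sum>n. seg_length \<epsilon> n / 2) = ennreal (2 * \<epsilon>)"
proof -
  let ?G = "\<Union>n. \<Union>m\<in>seg_centers \<epsilon> n. ball m (gap_radius \<epsilon> n)"
  have G: "?G \<in> sets lborel" by (intro sets.countable_UN image_subsetI sets.finite_UN) auto
  have "emeasure lborel (cantor_set \<epsilon>) + emeasure lborel ?G = emeasure lborel (cantor_set \<epsilon> \<union> ?G)"
    using G unfolding cantor_set_eq_Diff by (intro plus_emeasure) auto
  also have "cantor_set \<epsilon> \<union> ?G = {- \<epsilon>..\<epsilon>}"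
    using gaps_subset unfolding cantor_set_eq_Diff by blast
  finally show ?thesis using \<epsilon> by (simp add: emeasure_gaps)
qed

lemma lens_column:
  assumes "(x, y) \<in> lens_union \<epsilon>" "y \<noteq> 0"
  obtains n m where "m \<in> seg_centers \<epsilon> n" "x \<in> ball m (gap_radius \<epsilon> n)"
    "\<bar>y\<bar> \<le> arc_profile (gap_radius \<epsilon> n) (x - m)"
proof -
  obtain n m where m: "m \<in> seg_centers \<epsilon> n" "\<bar>y\<bar> \<le> arc_profile (gap_radius \<epsilon> n) (x - m)"
    using assms(1) by (auto simp: lens_union_levels[OF \<epsilon>] lens_level_def mem_translate_lens simp del: image_iff)
  then have "x \<in> ball m (gap_radius \<epsilon> n)"
    using assms(2) by (auto simp: arc_profile_def dist_real_def abs_less_iff split: if_splits)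
  then show ?thesis using that m by blast
qed

text \<open>Points off the axis outside the lenses are outside their closure, so it suffices to approximate
  vertically by such points.\<close>

lemma frontier_Omega_I:
  assumes "(x, y) \<in> closure (lens_union \<epsilon>)"
    and "\<And>e. 0 < e \<Longrightarrow> \<exists>y'. y' \<noteq> 0 \<and> \<bar>y' - y\<bar> < e \<and> (x, y') \<notin> lens_union \<epsilon>"
  shows "(x, y) \<in> frontier (Omega \<epsilon>)"
proof -
  let ?F = "lens_union \<epsilon>"
  have "(x, y) \<in> cball 0 \<epsilon>" using assms(1) lens_union_subset_cball[OF \<epsilon>] by blast
  then have "(x, y) \<in> ball 0 1" using \<epsilon> by auto
  moreover have "(x, y) \<in> closure (- closure ?F)"
  proof (unfold closure_approachable, intro allI impI)
    fix e :: real assume "0 < e"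
    then obtain y' where "y' \<noteq> 0" "\<bar>y' - y\<bar> < e" "(x, y') \<notin> ?F" using assms(2) by blast
    then show "\<exists>p\<in>- closure ?F. dist p (x, y) < e"
      using closure_lens_union_off_axis[OF \<epsilon>] by (intro bexI[of _ "(x, y')"]) (auto simp: dist_Pair_Pair dist_real_def)
  qed
  ultimately have "(x, y) \<in> closure (Omega \<epsilon>)"
    unfolding Omega_def Diff_eq using open_Int_closure_subset[of "ball 0 1" "- closure ?F"] by auto
  moreover have "(x, y) \<notin> interior (Omega \<epsilon>)"
    using assms(1) interior_subset by (auto simp: Omega_def)
  ultimately show ?thesis by (simp add: frontier_def)
qed

lemma sphere_subset_frontier_Omega: "sphere 0 1 \<subseteq> frontier (Omega \<epsilon>)"
proof
  fix p :: "real \<times> real" assume "p \<in> sphere 0 1"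
  then have p: "norm p = 1" by simp
  have "p \<in> closure (Omega \<epsilon>)"
  proof (unfold closure_approachable, intro allI impI)
    fix e :: real assume e: "0 < e"
    \<comment> \<open>The annulus \<open>\<epsilon> < norm q < 1\<close> belongs to the set, because all lenses have norm at most \<open>\<epsilon>\<close>.\<close>
    define t where "t = (max \<epsilon> (1 - e) + 1) / 2"
    have t: "\<epsilon> < t" "1 - e < t" "t < 1" using e \<epsilon> by (auto simp: t_def)
    have "t *\<^sub>R p \<in> Omega \<epsilon>"
      using lens_union_subset_cball[OF \<epsilon>] t p \<epsilon> by (auto simp: Omega_def)
    moreover have "t *\<^sub>R p - p = (t - 1) *\<^sub>R p" by (simp add: algebra_simps)
    then have "dist (t *\<^sub>R p) p < e" using t p by (simp add: dist_norm)
    ultimately show "\<exists>q\<in>Omega \<epsilon>. dist q p < e" by blast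
  qed
  moreover have "p \<notin> interior (Omega \<epsilon>)"
    using p interior_subset by (fastforce simp: Omega_def)
  ultimately show "p \<in> frontier (Omega \<epsilon>)" by (simp add: frontier_def)
qed

text \<open>Only one lens lies over \<open>x\<close>, so moving away from the axis leaves all lenses.\<close>

lemma lens_boundary_subset_frontier_Omega:
  assumes m: "m \<in> seg_centers \<epsilon> n" "x \<in> ball m (gap_radius \<epsilon> n)" and "\<bar>y\<bar> = arc_profile (gap_radius \<epsilon> n) (x - m)"
  shows "(x, y) \<in> frontier (Omega \<epsilon>)"
proof (rule frontier_Omega_I)
  have "(x, y) \<in> (+) (m, 0) ` lens (gap_radius \<epsilon> n)"
    using assms unfolding mem_translate_lens by (simp add: dist_real_def abs_minus_commute)
  then have "(x, y) \<in> lens_union \<epsilon>"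
    using m(1) by (auto simp: lens_union_levels[OF \<epsilon>] lens_level_def simp del: image_iff)
  then show "(x, y) \<in> closure (lens_union \<epsilon>)" using closure_subset by blast
  fix e :: real assume "0 < e"
  define y' where "y' = (if 0 \<le> y then y + e / 2 else y - e / 2)"
  have y': "y' \<noteq> 0" "\<bar>y' - y\<bar> < e" "\<bar>y\<bar> < \<bar>y'\<bar>" using \<open>0 < e\<close> by (auto simp: y'_def)
  have "(x, y') \<notin> lens_union \<epsilon>"
  proof
    assume "(x, y') \<in> lens_union \<epsilon>"
    then obtain k c where c: "c \<in> seg_centers \<epsilon> k" "x \<in> ball c (gap_radius \<epsilon> k)"
      "\<bar>y'\<bar> \<le> arc_profile (gap_radius \<epsilon> k) (x - c)"
      using lens_column y'(1) by blast
    have "(k, c) = (n, m)"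
    proof (rule ccontr)
      assume "(k, c) \<noteq> (n, m)"
      then have "gap_radius \<epsilon> k + gap_radius \<epsilon> n < \<bar>c - m\<bar>" using c(1) m(1) by (intro gaps_separated[OF \<epsilon>])
      then show False using c(2) m(2) by (simp add: dist_real_def)
    qed
    then show False using c(3) assms(3) y'(3) by simp
  qed
  then show "\<exists>y'. y' \<noteq> 0 \<and> \<bar>y' - y\<bar> < e \<and> (x, y') \<notin> lens_union \<epsilon>" using y' by blast
qed

text \<open>Gap centres accumulate at every point of the Cantor set, but no lens reaches above such a point.\<close>

lemma cantor_set_subset_frontier_Omega:
  assumes x: "x \<in> cantor_set \<epsilon>"
  shows "(x, 0) \<in> frontier (Omega \<epsilon>)"
proof (rule frontier_Omega_I)
  show "(x, 0) \<in> closure (lens_union \<epsilon>)"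
  proof (unfold closure_approachable, intro allI impI)
    fix e :: real assume "0 < e"
    have "seg_length \<epsilon> \<longlonglongrightarrow> 0" by (rule summable_LIMSEQ_zero[OF summable_seg_length[OF \<epsilon>]])
    then have "eventually (\<lambda>n. seg_length \<epsilon> n < e) sequentially"
      using \<open>0 < e\<close> by (rule order_tendstoD)
    then obtain n where n: "seg_length \<epsilon> n < e" by (auto simp: eventually_sequentially)
    obtain m where m: "m \<in> seg_centers \<epsilon> n" "\<bar>m - x\<bar> \<le> seg_length \<epsilon> n / 2"
      using x by (auto simp: cantor_set_def cantor_intervals_def dist_real_def)
    have "(m, 0) \<in> (+) (m, 0) ` lens (gap_radius \<epsilon> n)"
      using gap_radius_pos[OF \<epsilon>(1), of n] unfolding mem_translate_lens by (simp add: arc_profile_nonneg)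
    then have "(m, 0) \<in> lens_union \<epsilon>"
      using m(1) by (auto simp: lens_union_levels[OF \<epsilon>] lens_level_def simp del: image_iff)
    moreover have "dist (m, 0 :: real) (x, 0) < e"
      using m(2) n seg_length_pos[OF \<epsilon>(1), of n] by (simp add: dist_Pair_Pair dist_real_def)
    ultimately show "\<exists>p\<in>lens_union \<epsilon>. dist p (x, 0) < e" by blast
  qed
  fix e :: real assume "0 < e"
  have "(x, e / 2) \<notin> lens_union \<epsilon>"
  proof
    assume "(x, e / 2) \<in> lens_union \<epsilon>"
    then obtain n m where "m \<in> seg_centers \<epsilon> n" "x \<in> ball m (gap_radius \<epsilon> n)"
      using lens_column \<open>0 < e\<close> by (metis half_gt_zero_iff less_irrefl)
    then show False using x unfolding cantor_set_eq_Diff by blast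
  qed
  then show "\<exists>y'. y' \<noteq> 0 \<and> \<bar>y' - 0\<bar> < e \<and> (x, y') \<notin> lens_union \<epsilon>"
    using \<open>0 < e\<close> by (intro exI[of _ "e / 2"]) auto
qed

text \<open>The circle, the upper arcs at height at least \<open>h\<close>, the lower arcs at depth at least \<open>h\<close> and the
  Cantor set have mutual distance at least \<open>min h (1 - \<epsilon>)\<close>, and the projections of the last
  three contain the shortened gaps, again the shortened gaps, and the Cantor set.\<close>

lemma hausdorff1_frontier_Omega_ge_shortened_gaps:
  assumes \<eta>: "0 < \<eta>" "\<eta> < 1"
  shows "ennreal (2 * pi) + (emeasure lborel (shortened_gaps \<epsilon> \<eta>) + (emeasure lborel (shortened_gaps \<epsilon> \<eta>)
    + emeasure lborel (cantor_set \<epsilon>))) \<le> hausdorff1 (frontier (Omega \<epsilon>))"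
proof -
  let ?G = "shortened_gaps \<epsilon> \<eta>"
  define h where "h = 1 - sqrt (1 - \<eta>\<^sup>2)"
  have h: "0 < h" using \<eta> by (simp add: h_def abs_square_less_1 power_less_one_iff)
  \<comment> \<open>The sign \<open>\<sigma>\<close> selects the upper or the lower arcs.\<close>
  define arcs where "arcs \<sigma> = {p \<in> frontier (Omega \<epsilon>) \<inter> cball 0 \<epsilon>. h \<le> \<sigma> * snd p}" for \<sigma> :: real
  define C where "C = (\<lambda>x. (x, 0 :: real)) ` cantor_set \<epsilon>"
  have arcs_ge: "emeasure lborel ?G \<le> hausdorff1 (arcs \<sigma>)" if \<sigma>: "\<sigma> = 1 \<or> \<sigma> = - 1" for \<sigma>
  proof (rule emeasure_fst_le_hausdorff1)
    show "?G \<in> sets borel"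
      unfolding shortened_gaps_def by (intro sets.countable_UN image_subsetI sets.finite_UN) auto
    show "?G \<subseteq> fst ` arcs \<sigma>"
    proof
      fix x assume "x \<in> ?G"
      then obtain n m where m: "m \<in> seg_centers \<epsilon> n" "\<bar>x - m\<bar> \<le> gap_radius \<epsilon> n - \<eta>"
        by (auto simp: shortened_gaps_def dist_real_def abs_minus_commute)
      let ?f = "arc_profile (gap_radius \<epsilon> n) (x - m)"
      have f: "h \<le> ?f" unfolding h_def
        using m(2) \<eta> gap_radius_le_half[OF \<epsilon>, of n] by (intro arc_profile_ge) auto
      have "(x, \<sigma> * ?f) \<in> frontier (Omega \<epsilon>)"
        using m \<eta> \<sigma> by (intro lens_boundary_subset_frontier_Omega[of m n])
          (auto simp: dist_real_def abs_minus_commute arc_profile_nonneg)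
      moreover have "(x, \<sigma> * ?f) \<in> cball 0 \<epsilon>"
      proof -
        have "(x, \<sigma> * ?f) \<in> (+) (m, 0) ` lens (gap_radius \<epsilon> n)"
          using m \<eta> \<sigma> unfolding mem_translate_lens by (auto simp: arc_profile_nonneg)
        then have "(x, \<sigma> * ?f) \<in> lens_union \<epsilon>"
          using m(1) by (auto simp: lens_union_levels[OF \<epsilon>] lens_level_def simp del: image_iff)
        then show ?thesis using lens_union_subset_cball[OF \<epsilon>] closure_subset by blast
      qed
      moreover have "h \<le> \<sigma> * (\<sigma> * ?f)" using \<sigma> f by auto
      ultimately have "(x, \<sigma> * ?f) \<in> arcs \<sigma>" by (simp add: arcs_def)
      then show "x \<in> fst ` arcs \<sigma>" by force
    qed
  qed
  have C_ge: "emeasure lborel (cantor_set \<epsilon>) \<le> hausdorff1 C"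
  proof (rule emeasure_fst_le_hausdorff1)
    have "closed (cantor_set \<epsilon>)"
      unfolding cantor_set_def cantor_intervals_def by (intro closed_INT ballI closed_UN) auto
    then show "cantor_set \<epsilon> \<in> sets borel" by simp
    show "cantor_set \<epsilon> \<subseteq> fst ` C" by (auto simp: C_def image_image)
  qed
  have C_sub: "C \<subseteq> frontier (Omega \<epsilon>) \<inter> cball 0 \<epsilon>"
  proof -
    have "\<bar>x\<bar> \<le> \<epsilon>" if "x \<in> cantor_set \<epsilon>" for x using that unfolding cantor_set_eq_Diff by auto
    then show ?thesis using cantor_set_subset_frontier_Omega by (auto simp: C_def norm_Pair)
  qed
  have snd_dist: "\<bar>snd p - snd q\<bar> \<le> dist p q" for p q :: "real \<times> real"
    using dist_snd_le[of p q] by (simp add: dist_real_def)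
  have "ennreal (2 * pi) + (emeasure lborel ?G + (emeasure lborel ?G + emeasure lborel (cantor_set \<epsilon>)))
      \<le> hausdorff1 (sphere 0 1 :: (real \<times> real) set) + (hausdorff1 (arcs 1) + (hausdorff1 (arcs (- 1)) + hausdorff1 C))"
    by (intro add_mono hausdorff1_unit_circle_ge arcs_ge C_ge) auto
  also have "\<dots> \<le> hausdorff1 (sphere 0 1 :: (real \<times> real) set) + (hausdorff1 (arcs 1) + hausdorff1 (arcs (- 1) \<union> C))"
  proof (intro add_mono order_refl hausdorff1_separated_Un[OF h])
    fix p q assume "p \<in> arcs (- 1)" "q \<in> C"
    then show "h \<le> dist p q" using snd_dist[of p q] by (auto simp: arcs_def C_def)
  qed
  also have "\<dots> \<le> hausdorff1 (sphere 0 1 :: (real \<times> real) set) + hausdorff1 (arcs 1 \<union> (arcs (- 1) \<union> C))"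
  proof (intro add_mono order_refl hausdorff1_separated_Un[OF h])
    fix p q assume "p \<in> arcs 1" "q \<in> arcs (- 1) \<union> C"
    then show "h \<le> dist p q" using snd_dist[of p q] h by (auto simp: arcs_def C_def)
  qed
  also have "\<dots> \<le> hausdorff1 (sphere 0 1 \<union> (arcs 1 \<union> (arcs (- 1) \<union> C)))"
  proof (rule hausdorff1_separated_Un)
    show "0 < 1 - \<epsilon>" using \<epsilon> by simp
    fix p q :: "real \<times> real" assume "p \<in> sphere 0 1" "q \<in> arcs 1 \<union> (arcs (- 1) \<union> C)"
    then have "norm p = 1" "norm q \<le> \<epsilon>" using C_sub by (auto simp: arcs_def)
    then show "1 - \<epsilon> \<le> dist p q" using norm_triangle_ineq2[of p q] by (simp add: dist_norm)
  qed
  also have "\<dots> \<le> hausdorff1 (frontier (Omega \<epsilon>))"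
    using sphere_subset_frontier_Omega C_sub by (intro hausdorff1_mono) (auto simp: arcs_def)
  finally show ?thesis .
qed

text \<open>The shortened gaps exhaust the gaps as \<open>\<eta>\<close> tends to 0, and the lengths of the gaps and of the
  Cantor set add up to \<open>2 * \<epsilon>\<close>.\<close>

lemma hausdorff1_frontier_Omega_ge:
  "ennreal (2 * pi + (\<Sum>n. seg_length \<epsilon> n / 2) + 2 * \<epsilon>) \<le> hausdorff1 (frontier (Omega \<epsilon>))"
proof -
  let ?T = "\<Sum>n. seg_length \<epsilon> n / 2" and ?C = "emeasure lborel (cantor_set \<epsilon>)"
  \<comment> \<open>The sequence starts at \<open>1 / 2\<close>, as the previous lemma asks for \<open>\<eta> < 1\<close>.\<close>
  let ?A = "\<lambda>k. shortened_gaps \<epsilon> (inverse (real (k + 2)))"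
  have "(\<lambda>k. emeasure lborel (?A k)) \<longlonglongrightarrow> emeasure lborel (\<Union>k. ?A k)"
  proof (rule Lim_emeasure_incseq)
    have "shortened_gaps \<epsilon> \<eta> \<in> sets lborel" for \<eta>
      unfolding shortened_gaps_def by (intro sets.countable_UN image_subsetI sets.finite_UN) auto
    then show "range ?A \<subseteq> sets lborel" by auto
    show "incseq ?A"
    proof (rule incseq_SucI)
      fix k
      have "inverse (real (Suc k + 2)) \<le> inverse (real (k + 2))" by (intro le_imp_inverse_le) auto
      then show "?A k \<subseteq> ?A (Suc k)"
        unfolding shortened_gaps_def by (intro UN_mono subset_cball) auto
    qed
  qed
  also have "(\<Union>k. ?A k) = (\<Union>n. \<Union>m\<in>seg_centers \<epsilon> n. ball m (gap_radius \<epsilon> n))"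
  proof -
    have "(\<Union>k. cball m (r - inverse (real (k + 2)))) = ball m r" for m r :: real
    proof (intro equalityI subsetI)
      fix x assume "x \<in> (\<Union>k. cball m (r - inverse (real (k + 2))))"
      then obtain k where "dist m x \<le> r - inverse (real (k + 2))" by auto
      moreover have "0 < inverse (real (k + 2))" by simp
      ultimately have "dist m x < r" by linarith
      then show "x \<in> ball m r" by simp
    next
      fix x assume "x \<in> ball m r"
      then obtain k where k: "inverse (real (Suc k)) < r - dist m x"
        using reals_Archimedean[of "r - dist m x"] by auto
      have "inverse (real (k + 2)) \<le> inverse (real (Suc k))" by (intro le_imp_inverse_le) auto
      then have "dist m x \<le> r - inverse (real (k + 2))" using k by linarith
      then have "x \<in> cball m (r - inverse (real (k + 2)))" by simp
      then show "x \<in> (\<Union>k. cball m (r - inverse (real (k + 2))))" by blast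
    qed
    moreover have "(\<Union>k. ?A k) =
        (\<Union>n. \<Union>m\<in>seg_centers \<epsilon> n. \<Union>k. cball m (gap_radius \<epsilon> n - inverse (real (k + 2))))"
      unfolding shortened_gaps_def by (intro equalityI subsetI) (simp_all only: UN_iff, blast+)
    ultimately show ?thesis by simp
  qed
  finally have lim: "(\<lambda>k. emeasure lborel (?A k)) \<longlonglongrightarrow> ennreal ?T" by (simp only: emeasure_gaps)
  have "ennreal (2 * pi) + (ennreal ?T + (ennreal ?T + ?C)) \<le> hausdorff1 (frontier (Omega \<epsilon>))"
  proof (rule LIMSEQ_le_const2)
    show "(\<lambda>k. ennreal (2 * pi) + (emeasure lborel (?A k) + (emeasure lborel (?A k) + ?C)))
        \<longlonglongrightarrow> ennreal (2 * pi) + (ennreal ?T + (ennreal ?T + ?C))"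
      by (intro tendsto_add lim tendsto_const)
    have "inverse (real (k + 2)) < 1" for k by (simp add: inverse_less_1_iff)
    then show "\<exists>N. \<forall>k\<ge>N. ennreal (2 * pi) + (emeasure lborel (?A k) + (emeasure lborel (?A k) + ?C))
        \<le> hausdorff1 (frontier (Omega \<epsilon>))"
      by (intro exI[of _ 0] allI impI hausdorff1_frontier_Omega_ge_shortened_gaps) auto
  qed
  moreover have "0 \<le> ?T" by (rule total_gap_length_nonneg[OF \<epsilon>])
  ultimately show ?thesis
    using emeasure_cantor_set \<epsilon> by (simp add: add.commute[of "ennreal ?T" ?C] add.assoc ennreal_plus[symmetric] del: ennreal_plus)
qed

end

theorem proposition2p2:
  fixes \<epsilon> :: real
  assumes "0 < \<epsilon>" and "\<epsilon> < 1"
  shows "perimeter (Omega \<epsilon>) < hausdorff1 (frontier (Omega \<epsilon>))"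
proof -
  let ?T = "\<Sum>n. seg_length \<epsilon> n / 2"
  have T: "0 \<le> ?T" by (rule total_gap_length_nonneg[OF assms])
  have "perimeter (Omega \<epsilon>) \<le> ennreal (2 * pi + 58 / 25 * ?T)"
    by (rule perimeter_Omega_le[OF assms])
  \<comment> \<open>Since \<open>?T \<le> 3 / 2 * \<epsilon>\<close>, the term \<open>33 / 25 * ?T\<close> is at most \<open>99 / 50 * \<epsilon>\<close>.\<close>
  also have "\<dots> < ennreal (2 * pi + ?T + 2 * \<epsilon>)"
    using total_gap_length_le[OF assms] T assms pi_gt_zero by (intro ennreal_lessI; linarith)
  also have "\<dots> \<le> hausdorff1 (frontier (Omega \<epsilon>))"
    by (rule hausdorff1_frontier_Omega_ge[OF assms])
  finally show ?thesis .
qed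

end
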